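(* Let $X$ be a Banach space over $\mathbb{K}=\mathbb{R}$ or $\mathbb{C}$. If $\cot X>2$, then $\mathcal{L}_X\geq(\cot X)^{*}$, where $\mathcal{L}_X:=\inf\{r : \mathcal{L}_{d,r}(^{2}X)=\mathcal{L}(^{2}X)\}$ and $(\cot X)^{*}$ is the conjugate of $\cot X$.
   Context: $\cot X$ denotes the infimum of the $q\in[2,\infty]$ such that $X$ has cotype $q$. The conjugate $q^{*}$ of $q>1$ is given by $\frac1q+\frac1{q^{*}}=1$ (with $\infty^{*}=1$). $\mathcal{L}(^{2}X)$ is the space of all continuous bilinear forms $A\colon X\times X\to\mathbb{K}$. For $r>0$, a sequence $(x_j)_{j=1}^\infty$ in $X$ is weakly $r$-summable if $\sup_{\varphi\in B_{X^{*}}}\left(\sum_{j=1}^\infty|\varphi(x_j)|^{r}\right)^{1/r}<\infty$, where $B_{X^{*}}$ is the closed unit ball of the dual $X^{*}$. A form $A\in\mathcal{L}(^{2}X)$ is $r$-dominated if $(A(x_j,y_j))_{j=1}^\infty\in\ell_{r/2}$ (i.e. $\sum_j|A(x_j,y_j)|^{r/2}<\infty$) whenever $(x_j)_{j=1}^\infty$ and $(y_j)_{j=1}^\infty$ are weakly $r$-summable in $X$. $\mathcal{L}_{d,r}(^{2}X)$ is the set of all $r$-dominated $A\in\mathcal{L}(^{2}X)$. In the definition of $\mathcal{L}_X$, $r$ ranges over the positive real numbers and $\inf\emptyset=+\infty$. *)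

theory Defs
  imports "HOL-Analysis.Analysis"
begin

(* A Banach space over the scalar field 'k is a type of class banach together with a
   scalar multiplication by 'k extending the built-in real one.  Instances of interest:
   'k = real (which forces smul = scaleR) and 'k = complex. *)
locale banach_space_over = vector_space smul
  for smul :: "'k::real_normed_field \<Rightarrow> 'a::banach \<Rightarrow> 'a" +
  assumes norm_scale: "norm (smul c x) = norm c * norm x"
    and scale_of_real: "smul (of_real t) x = t *\<^sub>R x"

lemma banach_space_over_scaleR: "banach_space_over ((*\<^sub>R) :: real \<Rightarrow> 'a::banach \<Rightarrow> 'a)"
  by unfold_locales (auto simp: algebra_simps)

(* The L2 Rademacher average (E || sum_i eps_i x_i ||^2)^(1/2), written as the mean over
   all sign choices. *)
definition rademacher_avg :: "nat \<Rightarrow> (nat \<Rightarrow> 'a::real_normed_vector) \<Rightarrow> real" where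
  "rademacher_avg n x =
     sqrt ((\<Sum>\<epsilon>\<in>{..<n} \<rightarrow>\<^sub>E {-1, 1::real}. (norm (\<Sum>i<n. \<epsilon> i *\<^sub>R x i))\<^sup>2) / 2 ^ n)"

(* Only meant for q in [2,\<infinity>]; for q = \<infinity> the left-hand side is the maximum of the norms. *)
definition has_cotype :: "'a::real_normed_vector itself \<Rightarrow> ereal \<Rightarrow> bool" where
  "has_cotype _ q \<longleftrightarrow> (\<exists>C. \<forall>n (x :: nat \<Rightarrow> 'a).
     (if q = \<infinity> then \<forall>i<n. norm (x i) \<le> C * rademacher_avg n x
      else (\<Sum>i<n. norm (x i) powr real_of_ereal q) powr (1 / real_of_ereal q)
             \<le> C * rademacher_avg n x))"

definition cotype_inf :: "'a::real_normed_vector itself \<Rightarrow> ereal" where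
  "cotype_inf X = Inf {q. 2 \<le> q \<and> has_cotype X q}"

definition conjugate_exponent :: "ereal \<Rightarrow> ereal" where
  "conjugate_exponent q = (THE p. 1 \<le> p \<and> 1 / q + 1 / p = 1)"

lemma conjugate_exponent_infinity: "conjugate_exponent \<infinity> = 1"
  unfolding conjugate_exponent_def
proof (rule the_equality)
  fix p :: ereal assume "1 \<le> p \<and> 1 / \<infinity> + 1 / p = 1"
  then show "p = 1" by (cases p) (auto simp: one_ereal_def divide_ereal_def split: if_splits)
qed (simp add: divide_ereal_def one_ereal_def)

lemma conjugate_exponent_ereal:
  assumes "1 < q" shows "conjugate_exponent (ereal q) = ereal (q / (q - 1))"
  unfolding conjugate_exponent_def
proof (rule the_equality)
  show "1 \<le> ereal (q / (q - 1)) \<and> 1 / ereal q + 1 / ereal (q / (q - 1)) = 1"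
    using assms by (auto simp: one_ereal_def field_simps)
next
  fix p :: ereal assume p: "1 \<le> p \<and> 1 / ereal q + 1 / p = 1"
  show "p = ereal (q / (q - 1))"
  proof (cases p)
    case (real t)
    then have "1 \<le> t" "1 / q + 1 / t = 1"
      using p assms by (auto simp: one_ereal_def split: if_splits)
    then have "t = q / (q - 1)" using assms by (simp add: field_simps)
    then show ?thesis using real by simp
  qed (use p assms in \<open>auto simp: one_ereal_def split: if_splits\<close>)
qed

definition dual_unit_ball ::
    "('k::real_normed_field \<Rightarrow> 'a::real_normed_vector \<Rightarrow> 'a) \<Rightarrow> ('a \<Rightarrow> 'k) set" where
  "dual_unit_ball smul =
     {\<phi>. bounded_linear \<phi> \<and> (\<forall>c x. \<phi> (smul c x) = c * \<phi> x) \<and> onorm \<phi> \<le> 1}"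

(* Continuity of a bilinear form is boundedness; bounded_bilinear is real bilinearity, so
   homogeneity over 'k is added in each variable. *)
definition bilinear_forms ::
    "('k::real_normed_field \<Rightarrow> 'a::real_normed_vector \<Rightarrow> 'a) \<Rightarrow> ('a \<Rightarrow> 'a \<Rightarrow> 'k) set" where
  "bilinear_forms smul =
     {A. bounded_bilinear A \<and>
         (\<forall>c x y. A (smul c x) y = c * A x y \<and> A x (smul c y) = c * A x y)}"

definition weakly_summable ::
    "('k::real_normed_field \<Rightarrow> 'a::real_normed_vector \<Rightarrow> 'a) \<Rightarrow> real \<Rightarrow> (nat \<Rightarrow> 'a) \<Rightarrow> bool" where
  "weakly_summable smul r x \<longleftrightarrow> (\<exists>M. \<forall>\<phi>\<in>dual_unit_ball smul.
     summable (\<lambda>j. norm (\<phi> (x j)) powr r) \<and>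
     (\<Sum>j. norm (\<phi> (x j)) powr r) powr (1 / r) \<le> M)"

definition dominated_forms ::
    "('k::real_normed_field \<Rightarrow> 'a::real_normed_vector \<Rightarrow> 'a) \<Rightarrow> real \<Rightarrow> ('a \<Rightarrow> 'a \<Rightarrow> 'k) set" where
  "dominated_forms smul r =
     {A \<in> bilinear_forms smul. \<forall>x y. weakly_summable smul r x \<longrightarrow> weakly_summable smul r y
        \<longrightarrow> summable (\<lambda>j. norm (A (x j) (y j)) powr (r / 2))}"

definition domination_index ::
    "('k::real_normed_field \<Rightarrow> 'a::real_normed_vector \<Rightarrow> 'a) \<Rightarrow> ereal" where
  "domination_index smul =
     Inf {ereal r | r. 0 < r \<and> dominated_forms smul r = bilinear_forms smul}"

end

theory Submission
  imports Defs
begin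

text \<open>
  Let \<open>q = cot X > 2\<close>. Then \<open>q\<^sup>* \<le> 2\<close>, so it is enough to find, for every \<open>r < 2\<close>, a form
  that is not \<open>r\<close>-dominated; the proof thus gives the lower bound 2.

  Consider vectors \<open>x\<^sub>1, \<dots>, x\<^sub>m\<close> of norm at least 1 with norming functionals \<open>\<phi>\<^sub>i\<close>.
  The forms \<open>1/m \<Sum> \<plusminus> \<phi>\<^sub>i \<otimes> \<phi>\<^sub>i\<close> have norm at most 1, and for some choice of the signs
  the sum of the \<open>\<bar>A(x\<^sub>i, x\<^sub>i)\<bar> powr (r/2)\<close> is at least \<open>m powr (1 - r/2) / 2\<close>
  (\<open>bilinear_form_large_on_diagonal\<close>). If all forms were \<open>r\<close>-dominated, then the weak
  \<open>r\<close>-sums \<open>sup \<Sum> \<bar>\<phi>(x\<^sub>i)\<bar> powr r\<close> of such systems would therefore have to be at least of order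
  \<open>m powr (1 - r/2)\<close>. For the unit vectors of \<open>\<ell>\<^sub>q\<close> they are smaller by a power of
  \<open>m\<close>, because the functionals there satisfy
  \<open>\<Sum>i\<in>B. \<bar>\<phi>(x\<^sub>i)\<bar> \<le> card B powr (1/q)\<close> for all sets \<open>B\<close> and \<open>1/q < 1/2\<close>.

  The main point is that every \<open>X\<close> with \<open>cot X > 2\<close> contains systems that behave in this way up to factors
  \<open>C * m powr \<delta>\<close> with \<open>\<delta>\<close> arbitrarily small (\<open>upper_estimates\<close>). This weak form of the
  Maurey--Pisier theorem is proved directly in four steps. Failure of cotype \<open>p\<close> for \<open>p < q\<close> gives
  large systems \<open>S\<close> with Rademacher average at most about \<open>card S powr (1/q)\<close>
  (\<open>large_system_without_cotype\<close>). By cotype of an exponent near \<open>q\<close>, the disjoint subsets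
  whose average is too large cannot fill half of \<open>S\<close>; removing a maximal family of them leaves a system
  all of whose subsets have small averages (\<open>flat_part_ravg\<close>). To replace averages by maxima over
  the signs, the system is halved repeatedly by random signs: by the contraction principle each halving
  divides the maximum by 2, up to one average (\<open>max_signed_halving\<close>). The maximum starts within a
  factor \<open>sqrt (card S)\<close> of the average, and since \<open>1/q < 1/2\<close> this factor is used up when the
  cardinality has dropped to a fixed power of \<open>card S\<close> (\<open>sparse_part\<close>). A second exhaustion then
  makes the maxima small for all subsets (\<open>flat_part_max_signed\<close>).

  Hence there are finite blocks with weak \<open>r\<close>-sums at most 1 on which forms of norm at most 1 have
  arbitrarily large diagonal sums (\<open>undominated_blocks\<close>). The uniform boundedness principle, in a
  version for subadditive functionals, condenses them into a single weakly \<open>r\<close>-summable sequence and a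
  single form (\<open>undominated_form_exists\<close>).
\<close>

section \<open>Norming functionals\<close>

text \<open>The functionals are bounded on one side only, which is the form that the extension argument
  produces; replacing \<open>y\<close> by \<open>- y\<close> gives the two-sided bound.\<close>

definition dual_ball :: "('a::real_normed_vector \<Rightarrow> real) set" where
  "dual_ball = {f. linear f \<and> (\<forall>y. f y \<le> norm y)}"

lemma dual_ballD:
  assumes "f \<in> dual_ball"
  shows dual_ball_linear: "linear f" and dual_ball_le: "f y \<le> norm y"
    and dual_ball_abs_le: "\<bar>f y\<bar> \<le> norm y"
proof -
  show l: "linear f" and le: "f y \<le> norm y" for y
    using assms by (auto simp: dual_ball_def)
  show "\<bar>f y\<bar> \<le> norm y"
    using le[of y] le[of "- y"] linear_neg[OF l, of y] by simp
qed

lemma zero_in_dual_ball: "(\<lambda>_. 0) \<in> dual_ball"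
  by (auto simp: dual_ball_def linear_iff)

text \<open>One step of the Hahn--Banach argument, for functionals represented by their graphs. A subspace
  of \<open>X \<times> \<real>\<close> on which \<open>t \<le> norm x\<close> holds is automatically single-valued, so
  this inequality is the only thing that must survive the extension. The new value \<open>c\<close> at
  \<open>y\<close> exists because every lower bound \<open>t - norm (u - y)\<close> lies below every upper bound
  \<open>norm (u' + y) - t'\<close>, by the triangle inequality applied to \<open>u + u'\<close>.\<close>

lemma dominated_graph_extend:
  fixes M :: "('a::real_normed_vector \<times> real) set"
  assumes sub: "subspace M" and dom: "\<And>x t. (x, t) \<in> M \<Longrightarrow> t \<le> norm x"
  obtains N c where "subspace N" "M \<subseteq> N" "(y, c) \<in> N" "\<And>x t. (x, t) \<in> N \<Longrightarrow> t \<le> norm x"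
proof -
  define c where "c = (SUP m\<in>M. snd m - norm (fst m - y))"
  have bound: "snd m - norm (fst m - y) \<le> norm (fst m' + y) - snd m'" if "m \<in> M" "m' \<in> M" for m m'
  proof -
    have "m + m' \<in> M" using sub that by (rule subspace_add)
    then have "snd m + snd m' \<le> norm (fst m + fst m')"
      using dom[of "fst m + fst m'" "snd m + snd m'"] by (simp add: plus_prod_def)
    also have "\<dots> = norm ((fst m - y) + (fst m' + y))" by (simp add: algebra_simps)
    also have "\<dots> \<le> norm (fst m - y) + norm (fst m' + y)" by (rule norm_triangle_ineq)
    finally show ?thesis by simp
  qed
  have z: "0 \<in> M" using sub by (rule subspace_0)
  have bdd: "bdd_above ((\<lambda>m. snd m - norm (fst m - y)) ` M)"
    by (rule bdd_aboveI2[where M="norm (fst 0 + y) - snd (0 :: 'a \<times> real)"]) (use bound[OF _ z] in auto)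
  have lo: "snd m - norm (fst m - y) \<le> c" if "m \<in> M" for m
    unfolding c_def by (rule cSUP_upper[OF that bdd])
  have hi: "c \<le> norm (fst m + y) - snd m" if "m \<in> M" for m
    unfolding c_def by (rule cSUP_least) (use z bound that in auto)
  define N where "N = {a + b | a b. a \<in> M \<and> b \<in> span {(y, c)}}"
  have N: "subspace N" unfolding N_def by (intro subspace_sums sub subspace_span)
  have MN: "M \<subseteq> N"
  proof
    fix m assume "m \<in> M"
    then have "m + 0 \<in> N" unfolding N_def using span_zero by blast
    then show "m \<in> N" by simp
  qed
  have "0 + (y, c) \<in> N" unfolding N_def using z span_base by blast
  then have yc: "(y, c) \<in> N" by simp
  have dN: "t \<le> norm x" if xt: "(x, t) \<in> N" for x t
  proof -
    obtain a b where ab: "(x, t) = a + b" "a \<in> M" "b \<in> span {(y, c)}"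
      using xt unfolding N_def by blast
    obtain s where b: "b = s *\<^sub>R (y, c)" using ab(3) by (auto simp: span_singleton)
    have x: "x = fst a + s *\<^sub>R y" and t: "t = snd a + s * c"
      using ab(1) b by (auto simp: prod_eq_iff)
    \<comment> \<open>After division by \<open>\<bar>s\<bar>\<close> the claim is one of the two bounds that squeeze \<open>c\<close>.\<close>
    consider "s = 0" | "s > 0" | "s < 0" by linarith
    then show ?thesis
    proof cases
      case 1
      then show ?thesis using dom[of "fst a" "snd a"] ab(2) x t by simp
    next
      case 2
      have "(1/s) *\<^sub>R a \<in> M" using sub ab(2) by (rule subspace_scale)
      then have "c \<le> norm ((1/s) *\<^sub>R fst a + y) - snd a / s"
        using hi[of "(1/s) *\<^sub>R a"] by (simp add: divide_inverse_commute)
      also have "(1/s) *\<^sub>R fst a + y = (1/s) *\<^sub>R x" using 2 x by (simp add: scaleR_add_right)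
      finally show ?thesis using 2 t by (simp add: field_simps)
    next
      case 3
      define r where "r = - s"
      have r: "r > 0" "s = - r" using 3 by (auto simp: r_def)
      have "(1/r) *\<^sub>R a \<in> M" using sub ab(2) by (rule subspace_scale)
      then have "snd a / r - norm ((1/r) *\<^sub>R fst a - y) \<le> c"
        using lo[of "(1/r) *\<^sub>R a"] by (simp add: divide_inverse_commute)
      also have "(1/r) *\<^sub>R fst a - y = (1/r) *\<^sub>R x" using r x by (simp add: scaleR_diff_right)
      finally show ?thesis using r t by (simp add: field_simps)
    qed
  qed
  from that[OF N MN yc dN] show thesis .
qed

lemma subspace_Union_chain:
  assumes "subset.chain \<A> \<C>" "\<C> \<noteq> {}" "\<And>G. G \<in> \<A> \<Longrightarrow> subspace G"
  shows "subspace (\<Union>\<C>)"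
proof (rule subspaceI)
  have sub: "subspace G" if "G \<in> \<C>" for G using assms that by (auto simp: subset.chain_def)
  show "0 \<in> \<Union>\<C>" using assms(2) sub subspace_0 by blast
  show "c *\<^sub>R x \<in> \<Union>\<C>" if "x \<in> \<Union>\<C>" for c x using that sub subspace_scale by blast
  show "x + y \<in> \<Union>\<C>" if xy: "x \<in> \<Union>\<C>" "y \<in> \<Union>\<C>" for x y
  proof -
    obtain G H where GH: "G \<in> \<C>" "x \<in> G" "H \<in> \<C>" "y \<in> H" using xy by auto
    have "G \<subseteq> H \<or> H \<subseteq> G" using assms(1) GH by (auto simp: subset.chain_def)
    then show ?thesis using GH sub subspace_add by (meson UnionI in_mono)
  qed
qed

text \<open>By Zorn's lemma there is a maximal dominated graph above the line through
  \<open>(x, norm x)\<close>; if its domain were not everything, it could be extended.\<close>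

lemma norming_functional:
  fixes x :: "'a::real_normed_vector"
  obtains f where "f \<in> dual_ball" "f x = norm x"
proof -
  define \<A> where "\<A> = {G :: ('a \<times> real) set. subspace G \<and> (x, norm x) \<in> G \<and> (\<forall>(y, t)\<in>G. t \<le> norm y)}"
  have "t \<le> norm y" if "(y, t) \<in> span {(x, norm x)}" for y t
    using that by (auto simp: span_singleton intro!: mult_right_mono)
  then have "span {(x, norm x)} \<in> \<A>"
    by (auto simp: \<A>_def span_base)
  then have ne: "\<A> \<noteq> {}" by auto
  have "\<exists>M\<in>\<A>. \<forall>G\<in>\<A>. M \<subseteq> G \<longrightarrow> G = M"
  proof (rule subset_Zorn_nonempty[OF ne])
    fix \<C> assume C: "\<C> \<noteq> {}" "subset.chain \<A> \<C>"
    then have "subspace (\<Union>\<C>)" by (intro subspace_Union_chain) (auto simp: \<A>_def)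
    moreover have "\<C> \<subseteq> \<A>" using C by (simp add: subset.chain_def)
    ultimately show "\<Union>\<C> \<in> \<A>" using C(1) by (fastforce simp: \<A>_def)
  qed
  then obtain M where M: "M \<in> \<A>" and max: "\<And>G. G \<in> \<A> \<Longrightarrow> M \<subseteq> G \<Longrightarrow> G = M" by blast
  have sub: "subspace M" and xM: "(x, norm x) \<in> M" and dom: "\<And>y t. (y, t) \<in> M \<Longrightarrow> t \<le> norm y"
    using M by (auto simp: \<A>_def)
  have ex: "\<exists>t. (y, t) \<in> M" for y
  proof -
    obtain N c where N: "subspace N" "M \<subseteq> N" "(y, c) \<in> N" "\<And>x t. (x, t) \<in> N \<Longrightarrow> t \<le> norm x"
      using dominated_graph_extend[OF sub dom, of y] by metis
    then have "N \<in> \<A>" using xM by (auto simp: \<A>_def)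
    then show ?thesis using max N by blast
  qed
  have uniq: "s = t" if "(y, s) \<in> M" "(y, t) \<in> M" for y s t
  proof -
    have "(y, s) - (y, t) \<in> M" "(y, t) - (y, s) \<in> M" using subspace_diff[OF sub] that by blast+
    then show ?thesis using dom[of 0 "s - t"] dom[of 0 "t - s"] by simp
  qed
  define f where "f y = (THE t. (y, t) \<in> M)" for y
  have f: "f y = t" if "(y, t) \<in> M" for y t
    unfolding f_def using that uniq by blast
  have fM: "(y, f y) \<in> M" for y using ex f by metis
  have "linear f"
  proof (rule linearI)
    show "f (a + b) = f a + f b" for a b
      using subspace_add[OF sub fM[of a] fM[of b]] by (intro f) simp
    show "f (c *\<^sub>R a) = c *\<^sub>R f a" for c a
      using subspace_scale[OF sub fM[of a], of c] by (intro f) simp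
  qed
  then have "f \<in> dual_ball" using dom fM by (auto simp: dual_ball_def)
  with that show thesis using f[OF xM] by blast
qed

lemma dual_ball_sum: 
  assumes "f \<in> dual_ball" shows "f (\<Sum>i\<in>J. \<theta> i *\<^sub>R x i) = (\<Sum>i\<in>J. \<theta> i * f (x i))"
  using dual_ball_linear[OF assms] by (simp add: linear_sum linear_scale)

section \<open>Rademacher averages and maximal signed sums\<close>

definition signs :: "nat set \<Rightarrow> (nat \<Rightarrow> real) set" where
  "signs I = I \<rightarrow>\<^sub>E {-1, 1}"

text \<open>Multiplication by a sign pattern \<open>s\<close> permutes the cube \<open>signs I\<close>. Every use of the
  randomness of the signs below is an instance of this symmetry.\<close>

definition flip :: "nat set \<Rightarrow> (nat \<Rightarrow> real) \<Rightarrow> (nat \<Rightarrow> real) \<Rightarrow> nat \<Rightarrow> real" where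
  "flip I s \<epsilon> = restrict (\<lambda>i. s i * \<epsilon> i) I"

lemma finite_signs: "finite I \<Longrightarrow> finite (signs I)"
  by (auto simp: signs_def intro: finite_PiE)

lemma card_signs: "finite I \<Longrightarrow> card (signs I) = 2 ^ card I"
  by (simp add: signs_def card_PiE numeral_2_eq_2)

lemma signs_nonempty: "signs I \<noteq> {}"
  by (auto simp: signs_def PiE_eq_empty_iff)

lemma signsD: "\<epsilon> \<in> signs I \<Longrightarrow> i \<in> I \<Longrightarrow> \<epsilon> i = -1 \<or> \<epsilon> i = 1"
  by (auto simp: signs_def PiE_iff)

lemma signs_square: "\<epsilon> \<in> signs I \<Longrightarrow> i \<in> I \<Longrightarrow> \<epsilon> i * \<epsilon> i = 1"
  using signsD by fastforce

lemma flip_in_signs: "\<epsilon> \<in> signs I \<Longrightarrow> (\<And>i. i \<in> I \<Longrightarrow> s i = -1 \<or> s i = 1) \<Longrightarrow> flip I s \<epsilon> \<in> signs I"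
  by (fastforce simp: signs_def flip_def PiE_iff)

lemma flip_flip:
  assumes "\<epsilon> \<in> signs I" "\<And>i. i \<in> I \<Longrightarrow> s i = -1 \<or> s i = 1"
  shows "flip I s (flip I s \<epsilon>) = \<epsilon>"
proof
  fix i
  show "flip I s (flip I s \<epsilon>) i = \<epsilon> i"
    using assms(1) assms(2)[of i]
    by (cases "i \<in> I") (auto simp: flip_def signs_def PiE_iff extensional_def)
qed

lemma sum_signs_flip:
  assumes "\<And>i. i \<in> I \<Longrightarrow> s i = -1 \<or> s i = 1"
  shows "(\<Sum>\<epsilon>\<in>signs I. g (flip I s \<epsilon>)) = (\<Sum>\<epsilon>\<in>signs I. g \<epsilon>)"
  by (rule sum.reindex_bij_witness[where i="flip I s" and j="flip I s"])
    (auto simp: flip_flip flip_in_signs assms)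

text \<open>The average runs over the signs of the ambient set \<open>I\<close> even when only the vectors with
  index in \<open>J\<close> occur, so that averages over different subsets \<open>J\<close> live on one probability
  space.\<close>

definition ravg :: "nat set \<Rightarrow> (nat \<Rightarrow> 'a::real_normed_vector) \<Rightarrow> nat set \<Rightarrow> real" where
  "ravg I x J = sqrt ((\<Sum>\<epsilon>\<in>signs I. (norm (\<Sum>i\<in>J. \<epsilon> i *\<^sub>R x i))\<^sup>2) / 2 ^ card I)"

lemma rademacher_avg_eq_ravg: "rademacher_avg n x = ravg {..<n} x {..<n}"
  by (simp add: rademacher_avg_def ravg_def signs_def)

lemma ravg_nonneg: "0 \<le> ravg I x J"
  by (simp add: ravg_def sum_nonneg)

lemma ravg_square: "2 ^ card I * (ravg I x J)\<^sup>2 = (\<Sum>\<epsilon>\<in>signs I. (norm (\<Sum>i\<in>J. \<epsilon> i *\<^sub>R x i))\<^sup>2)"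
  by (simp add: ravg_def sum_nonneg)

lemma ravg_scale: "ravg I (\<lambda>i. c *\<^sub>R x i) J = \<bar>c\<bar> * ravg I x J"
proof -
  have "(\<Sum>i\<in>J. \<epsilon> i *\<^sub>R c *\<^sub>R x i) = c *\<^sub>R (\<Sum>i\<in>J. \<epsilon> i *\<^sub>R x i)" for \<epsilon>
    by (simp add: scaleR_sum_right mult.commute)
  then have "2 ^ card I * (ravg I (\<lambda>i. c *\<^sub>R x i) J)\<^sup>2 = 2 ^ card I * (\<bar>c\<bar> * ravg I x J)\<^sup>2"
    unfolding ravg_square by (simp add: power_mult_distrib ravg_square[symmetric] sum_distrib_left[symmetric] mult.left_commute)
  then show ?thesis by (simp add: ravg_nonneg)
qed

text \<open>Flipping the signs outside \<open>J\<close> and adding the two sums leaves twice the sum over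
  \<open>J\<close>, while the flip does not change the average over \<open>K\<close>.\<close>

lemma ravg_mono:
  assumes "finite I" "J \<subseteq> K" "K \<subseteq> I"
  shows "ravg I x J \<le> ravg I x K"
proof -
  define s :: "nat \<Rightarrow> real" where "s i = (if i \<in> J then 1 else -1)" for i
  have s: "s i = -1 \<or> s i = 1" for i by (simp add: s_def)
  define u where "u \<epsilon> = (\<Sum>i\<in>J. \<epsilon> i *\<^sub>R x i)" for \<epsilon>
  define v where "v \<epsilon> = (\<Sum>i\<in>K. \<epsilon> i *\<^sub>R x i)" for \<epsilon>
  have fin: "finite K" using assms finite_subset by blast
  have uv: "2 *\<^sub>R u \<epsilon> = v \<epsilon> + v (flip I s \<epsilon>)" for \<epsilon>
  proof -
    have "v (flip I s \<epsilon>) = (\<Sum>i\<in>K. (s i * \<epsilon> i) *\<^sub>R x i)"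
      unfolding v_def using assms by (intro sum.cong) (auto simp: flip_def)
    then have "v \<epsilon> + v (flip I s \<epsilon>) = (\<Sum>i\<in>K. (\<epsilon> i + s i * \<epsilon> i) *\<^sub>R x i)"
      by (simp add: v_def sum.distrib scaleR_add_left)
    also have "\<dots> = (\<Sum>i\<in>J. (\<epsilon> i + s i * \<epsilon> i) *\<^sub>R x i)"
      by (rule sum.mono_neutral_right) (use fin assms in \<open>auto simp: s_def\<close>)
    also have "\<dots> = 2 *\<^sub>R u \<epsilon>"
      unfolding u_def scaleR_sum_right by (intro sum.cong refl) (simp add: s_def)
    finally show ?thesis by simp
  qed
  have "2 * (norm (u \<epsilon>))\<^sup>2 \<le> (norm (v \<epsilon>))\<^sup>2 + (norm (v (flip I s \<epsilon>)))\<^sup>2" for \<epsilon>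
  proof -
    have "2 * norm (u \<epsilon>) \<le> norm (v \<epsilon>) + norm (v (flip I s \<epsilon>))"
      using norm_triangle_ineq[of "v \<epsilon>" "v (flip I s \<epsilon>)"] unfolding uv[symmetric] by simp
    then have "(2 * norm (u \<epsilon>))\<^sup>2 \<le> (norm (v \<epsilon>) + norm (v (flip I s \<epsilon>)))\<^sup>2"
      by (intro power_mono) auto
    also have "\<dots> \<le> 2 * ((norm (v \<epsilon>))\<^sup>2 + (norm (v (flip I s \<epsilon>)))\<^sup>2)"
      using sum_squares_bound[of "norm (v \<epsilon>)" "norm (v (flip I s \<epsilon>))"] by (simp add: power2_sum)
    finally show ?thesis by (simp add: power_mult_distrib)
  qed
  then have "(\<Sum>\<epsilon>\<in>signs I. 2 * (norm (u \<epsilon>))\<^sup>2)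
      \<le> (\<Sum>\<epsilon>\<in>signs I. (norm (v \<epsilon>))\<^sup>2 + (norm (v (flip I s \<epsilon>)))\<^sup>2)"
    by (intro sum_mono) auto
  also have "\<dots> = 2 * (\<Sum>\<epsilon>\<in>signs I. (norm (v \<epsilon>))\<^sup>2)"
    using sum_signs_flip[of I s "\<lambda>\<epsilon>. (norm (v \<epsilon>))\<^sup>2"] s by (simp add: sum.distrib)
  finally have "(\<Sum>\<epsilon>\<in>signs I. (norm (u \<epsilon>))\<^sup>2) \<le> (\<Sum>\<epsilon>\<in>signs I. (norm (v \<epsilon>))\<^sup>2)"
    by (simp add: sum_distrib_left[symmetric])
  then show ?thesis
    unfolding ravg_def u_def v_def by (intro real_sqrt_le_mono divide_right_mono) auto
qed

lemma norm_le_ravg: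
  assumes "finite I" "J \<subseteq> I" "i \<in> J"
  shows "norm (x i) \<le> ravg I x J"
proof -
  have "(\<Sum>\<epsilon>\<in>signs I. (norm (\<Sum>j\<in>{i}. \<epsilon> j *\<^sub>R x j))\<^sup>2) = (\<Sum>\<epsilon>\<in>signs I. (norm (x i))\<^sup>2)"
  proof (intro sum.cong refl)
    fix \<epsilon> assume "\<epsilon> \<in> signs I"
    then have "\<bar>\<epsilon> i\<bar> = 1" using signsD[of \<epsilon> I i] subsetD[OF assms(2,3)] by auto
    then show "(norm (\<Sum>j\<in>{i}. \<epsilon> j *\<^sub>R x j))\<^sup>2 = (norm (x i))\<^sup>2" by simp
  qed
  then have "(\<Sum>\<epsilon>\<in>signs I. (norm (\<Sum>j\<in>{i}. \<epsilon> j *\<^sub>R x j))\<^sup>2) = 2 ^ card I * (norm (x i))\<^sup>2"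
    using assms by (simp add: card_signs)
  then have "ravg I x {i} = norm (x i)" by (simp add: ravg_def)
  moreover have "ravg I x {i} \<le> ravg I x J" using assms by (intro ravg_mono) auto
  ultimately show ?thesis by simp
qed

lemma sum_norm_le_ravg:
  assumes "finite I"
  shows "(\<Sum>\<epsilon>\<in>signs I. norm (\<Sum>i\<in>J. \<epsilon> i *\<^sub>R x i)) \<le> 2 ^ card I * ravg I x J"
proof -
  have "(\<Sum>\<epsilon>\<in>signs I. norm (\<Sum>i\<in>J. \<epsilon> i *\<^sub>R x i))\<^sup>2 \<le> (2 ^ card I * ravg I x J)\<^sup>2"
    using sum_squared_le_sum_of_squares[of "\<lambda>\<epsilon>. norm (\<Sum>i\<in>J. \<epsilon> i *\<^sub>R x i)" "signs I"] assms
    unfolding ravg_square[symmetric]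
    by (simp add: card_signs power_mult_distrib power2_eq_square[of "2 ^ card I"] mult_ac)
  then show ?thesis by (rule power2_le_imp_le) (simp add: ravg_nonneg)
qed

lemma signs_orthogonal:
  assumes "finite I" "i \<in> I" "j \<in> I"
  shows "(\<Sum>\<epsilon>\<in>signs I. \<epsilon> i * \<epsilon> j) = (if i = j then 2 ^ card I else 0)"
proof (cases "i = j")
  case True
  then show ?thesis using assms signs_square by (simp add: card_signs)
next
  case False
  define s :: "nat \<Rightarrow> real" where "s k = (if k = i then -1 else 1)" for k
  have "(\<Sum>\<epsilon>\<in>signs I. flip I s \<epsilon> i * flip I s \<epsilon> j) = (\<Sum>\<epsilon>\<in>signs I. \<epsilon> i * \<epsilon> j)"
    by (rule sum_signs_flip[of I s "\<lambda>\<epsilon>. \<epsilon> i * \<epsilon> j"]) (simp add: s_def)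
  moreover have "flip I s \<epsilon> i * flip I s \<epsilon> j = - (\<epsilon> i * \<epsilon> j)" for \<epsilon>
    using False assms by (simp add: flip_def s_def)
  ultimately show ?thesis using False by (simp add: sum_negf)
qed

lemma sum_signs_square:
  assumes "finite I" "J \<subseteq> I"
  shows "(\<Sum>\<epsilon>\<in>signs I. (\<Sum>i\<in>J. \<epsilon> i * t i)\<^sup>2) = 2 ^ card I * (\<Sum>i\<in>J. (t i :: real)\<^sup>2)"
proof -
  have "finite J" using assms finite_subset by blast
  have "(\<Sum>\<epsilon>\<in>signs I. (\<Sum>i\<in>J. \<epsilon> i * t i)\<^sup>2)
      = (\<Sum>\<epsilon>\<in>signs I. \<Sum>i\<in>J. \<Sum>j\<in>J. (t i * t j) * (\<epsilon> i * \<epsilon> j))"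
    by (simp add: power2_eq_square sum_product mult_ac)
  also have "\<dots> = (\<Sum>i\<in>J. \<Sum>j\<in>J. \<Sum>\<epsilon>\<in>signs I. (t i * t j) * (\<epsilon> i * \<epsilon> j))"
    by (subst sum.swap) (intro sum.cong refl, rule sum.swap)
  also have "\<dots> = (\<Sum>i\<in>J. \<Sum>j\<in>J. (t i * t j) * (if i = j then 2 ^ card I else 0))"
    unfolding sum_distrib_left[symmetric]
    by (intro sum.cong refl) (use assms signs_orthogonal in \<open>auto simp: subset_eq\<close>)
  also have "\<dots> = 2 ^ card I * (\<Sum>i\<in>J. (t i)\<^sup>2)"
    using \<open>finite J\<close> by (simp add: if_distrib[of "(*) _"] sum.delta sum_distrib_left power2_eq_square mult_ac cong: if_cong)
  finally show ?thesis .
qed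

lemma sum_functional_square_le_ravg:
  assumes "finite I" "J \<subseteq> I" "f \<in> dual_ball"
  shows "(\<Sum>i\<in>J. (f (x i))\<^sup>2) \<le> (ravg I x J)\<^sup>2"
proof -
  have "2 ^ card I * (\<Sum>i\<in>J. (f (x i))\<^sup>2) = (\<Sum>\<epsilon>\<in>signs I. (\<Sum>i\<in>J. \<epsilon> i * f (x i))\<^sup>2)"
    using assms by (simp add: sum_signs_square)
  also have "\<dots> \<le> (\<Sum>\<epsilon>\<in>signs I. (norm (\<Sum>i\<in>J. \<epsilon> i *\<^sub>R x i))\<^sup>2)"
    using dual_ball_abs_le[OF assms(3)]
    by (intro sum_mono) (auto simp: dual_ball_sum[OF assms(3), symmetric] abs_le_square_iff[symmetric])
  also have "\<dots> = 2 ^ card I * (ravg I x J)\<^sup>2" by (simp add: ravg_square)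
  finally show ?thesis by simp
qed

definition max_signed :: "(nat \<Rightarrow> 'a::real_normed_vector) \<Rightarrow> nat set \<Rightarrow> real" where
  "max_signed x J = Max ((\<lambda>\<theta>. norm (\<Sum>i\<in>J. \<theta> i *\<^sub>R x i)) ` signs J)"

lemma norm_le_max_signed:
  assumes "finite J" "\<And>i. i \<in> J \<Longrightarrow> \<theta> i = -1 \<or> \<theta> i = 1"
  shows "norm (\<Sum>i\<in>J. \<theta> i *\<^sub>R x i) \<le> max_signed x J"
proof -
  have "restrict \<theta> J \<in> signs J" using assms by (auto simp: signs_def)
  then have "norm (\<Sum>i\<in>J. restrict \<theta> J i *\<^sub>R x i) \<le> max_signed x J"
    unfolding max_signed_def by (intro Max_ge finite_imageI finite_signs imageI assms)
  then show ?thesis by simp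
qed

lemma max_signed_attained:
  assumes "finite J"
  obtains \<theta> where "\<theta> \<in> signs J" "max_signed x J = norm (\<Sum>i\<in>J. \<theta> i *\<^sub>R x i)"
proof -
  have "max_signed x J \<in> (\<lambda>\<theta>. norm (\<Sum>i\<in>J. \<theta> i *\<^sub>R x i)) ` signs J"
    unfolding max_signed_def by (intro Max_in) (use assms finite_signs signs_nonempty in auto)
  then show thesis using that by auto
qed

lemma sum_abs_functional_le_max_signed:
  assumes "finite J" "f \<in> dual_ball"
  shows "(\<Sum>i\<in>J. \<bar>f (x i)\<bar>) \<le> max_signed x J"
proof -
  define \<theta> :: "nat \<Rightarrow> real" where "\<theta> i = (if f (x i) < 0 then -1 else 1)" for i
  have "(\<Sum>i\<in>J. \<bar>f (x i)\<bar>) = f (\<Sum>i\<in>J. \<theta> i *\<^sub>R x i)"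
    unfolding dual_ball_sum[OF assms(2)] by (intro sum.cong) (auto simp: \<theta>_def)
  also have "\<dots> \<le> norm (\<Sum>i\<in>J. \<theta> i *\<^sub>R x i)" by (rule dual_ball_le[OF assms(2)])
  also have "\<dots> \<le> max_signed x J" using assms by (intro norm_le_max_signed) (auto simp: \<theta>_def)
  finally show ?thesis .
qed

text \<open>A functional that norms an extremal signed sum attains the weak \<open>\<ell>\<^sub>1\<close> norm of the
  system, which therefore equals the maximum over the signs.\<close>

lemma max_signed_functional:
  assumes "finite J"
  obtains f where "f \<in> dual_ball" "max_signed x J = (\<Sum>i\<in>J. \<bar>f (x i)\<bar>)"
proof -
  obtain \<theta> where \<theta>: "\<theta> \<in> signs J" "max_signed x J = norm (\<Sum>i\<in>J. \<theta> i *\<^sub>R x i)"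
    using max_signed_attained[OF assms] by blast
  obtain f where f: "f \<in> dual_ball" "f (\<Sum>i\<in>J. \<theta> i *\<^sub>R x i) = norm (\<Sum>i\<in>J. \<theta> i *\<^sub>R x i)"
    by (rule norming_functional)
  have "max_signed x J = (\<Sum>i\<in>J. \<theta> i * f (x i))"
    using \<theta> f by (simp add: dual_ball_sum)
  also have "\<dots> \<le> (\<Sum>i\<in>J. \<bar>f (x i)\<bar>)"
    using signsD[OF \<theta>(1)] by (intro sum_mono) force
  finally have "max_signed x J = (\<Sum>i\<in>J. \<bar>f (x i)\<bar>)"
    using sum_abs_functional_le_max_signed[OF assms f(1), of x] by simp
  with f(1) that show thesis by blast
qed

lemma max_signed_nonneg: "finite J \<Longrightarrow> 0 \<le> max_signed x J"
  by (metis max_signed_attained norm_ge_zero)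

lemma max_signed_mono:
  assumes "finite K" "J \<subseteq> K"
  shows "max_signed x J \<le> max_signed x K"
proof -
  obtain f where f: "f \<in> dual_ball" "max_signed x J = (\<Sum>i\<in>J. \<bar>f (x i)\<bar>)"
    using max_signed_functional finite_subset[OF assms(2,1)] by metis
  have "(\<Sum>i\<in>J. \<bar>f (x i)\<bar>) \<le> (\<Sum>i\<in>K. \<bar>f (x i)\<bar>)" using assms by (intro sum_mono2) auto
  then show ?thesis using f sum_abs_functional_le_max_signed[OF assms(1) f(1), of x] by simp
qed

text \<open>By orthogonality of the signs, the \<open>\<ell>\<^sub>2\<close> norm of \<open>(f (x i))\<close> is at most the average;
  Cauchy--Schwarz turns this into a bound for the \<open>\<ell>\<^sub>1\<close> norm. The loss of a factor
  \<open>sqrt (card J)\<close> is repaired later by passing to much smaller sets.\<close>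

lemma max_signed_le_ravg:
  assumes "finite I" "J \<subseteq> I"
  shows "max_signed x J \<le> sqrt (card J) * ravg I x J"
proof -
  have fin: "finite J" using assms finite_subset by blast
  obtain f where f: "f \<in> dual_ball" "max_signed x J = (\<Sum>i\<in>J. \<bar>f (x i)\<bar>)"
    using max_signed_functional[OF fin] by metis
  have "(max_signed x J)\<^sup>2 \<le> (\<Sum>i\<in>J. (f (x i))\<^sup>2) * card J"
    using sum_squared_le_sum_of_squares[of "\<lambda>i. \<bar>f (x i)\<bar>" J] by (simp add: f(2))
  also have "\<dots> \<le> (ravg I x J)\<^sup>2 * card J"
    by (intro mult_right_mono sum_functional_square_le_ravg assms f) auto
  also have "\<dots> = (sqrt (card J) * ravg I x J)\<^sup>2" by (simp add: power_mult_distrib)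
  finally show ?thesis by (rule power2_le_imp_le) (simp add: ravg_nonneg)
qed

section \<open>Halving maximal signed sums\<close>

text \<open>The contraction principle for the absolute value, in a form without suprema: the functional may
  depend on the signs in an arbitrary way. The absolute values are removed one coordinate at a time.
  For two sign patterns that differ only at \<open>a\<close>, with functionals \<open>f\<close> and \<open>f'\<close>, the terms
  at \<open>a\<close> contribute \<open>\<bar>f (x a)\<bar> - \<bar>f' (x a)\<bar> \<le> \<bar>f (x a) - f' (x a)\<bar>\<close>, and the right-hand
  side is reached without absolute values after exchanging the two functionals if necessary.\<close>

lemma contraction_abs:
  assumes "finite I" "finite A" "A \<inter> B = {}" "A \<union> B \<subseteq> I"
    and "\<And>\<epsilon>. \<epsilon> \<in> signs I \<Longrightarrow> f \<epsilon> \<in> dual_ball"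
  shows "(\<Sum>\<epsilon>\<in>signs I. (\<Sum>i\<in>A. \<epsilon> i * \<bar>f \<epsilon> (x i)\<bar>) + (\<Sum>i\<in>B. \<epsilon> i * f \<epsilon> (x i)))
    \<le> (\<Sum>\<epsilon>\<in>signs I. norm (\<Sum>i\<in>A \<union> B. \<epsilon> i *\<^sub>R x i))"
  using assms(2-)
proof (induction A arbitrary: B f rule: finite_induct)
  case empty
  show ?case
  proof (rule sum_mono)
    fix \<epsilon> assume "\<epsilon> \<in> signs I"
    then have f: "f \<epsilon> \<in> dual_ball" using empty by simp
    show "(\<Sum>i\<in>{}. \<epsilon> i * \<bar>f \<epsilon> (x i)\<bar>) + (\<Sum>i\<in>B. \<epsilon> i * f \<epsilon> (x i)) \<le> norm (\<Sum>i\<in>{} \<union> B. \<epsilon> i *\<^sub>R x i)"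
      using dual_ball_le[OF f, of "\<Sum>i\<in>B. \<epsilon> i *\<^sub>R x i"] by (simp add: dual_ball_sum[OF f])
  qed
next
  case (insert a A)
  define s :: "nat \<Rightarrow> real" where "s i = (if i = a then -1 else 1)" for i
  define \<sigma> where "\<sigma> = flip I s"
  have s: "s i = -1 \<or> s i = 1" for i by (simp add: s_def)
  have aI: "a \<in> I" and AI: "A \<subseteq> I" and BI: "B \<subseteq> I" and aB: "a \<notin> B" and finB: "finite B"
    using insert.prems finite_subset[OF _ assms(1)] by auto
  have \<sigma>: "\<sigma> \<epsilon> \<in> signs I" "\<sigma> (\<sigma> \<epsilon>) = \<epsilon>" if "\<epsilon> \<in> signs I" for \<epsilon>
    using that s by (simp_all add: \<sigma>_def flip_in_signs flip_flip)
  have \<sigma>a: "\<sigma> \<epsilon> a = - \<epsilon> a" for \<epsilon> using aI by (simp add: \<sigma>_def flip_def s_def)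
  \<comment> \<open>Within each pair of sign patterns that differ only at \<open>a\<close>, the two functionals are
    exchanged whenever this increases the term at \<open>a\<close>; all other terms of the pair only
    change places.\<close>
  define g where "g \<epsilon> = (if \<epsilon> a * f \<epsilon> (x a) \<ge> \<epsilon> a * f (\<sigma> \<epsilon>) (x a) then f \<epsilon> else f (\<sigma> \<epsilon>))" for \<epsilon>
  define k where "k \<epsilon> \<phi> = (\<Sum>i\<in>A. \<epsilon> i * \<bar>\<phi> (x i)\<bar>) + (\<Sum>i\<in>B. \<epsilon> i * \<phi> (x i))" for \<epsilon> and \<phi> :: "'a \<Rightarrow> real"
  have k\<sigma>: "k (\<sigma> \<epsilon>) \<phi> = k \<epsilon> \<phi>" for \<epsilon> \<phi>
  proof -
    have "\<sigma> \<epsilon> i = \<epsilon> i" if "i \<in> A \<union> B" for i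
      using that insert.hyps aB AI BI by (auto simp: \<sigma>_def flip_def s_def)
    then show ?thesis unfolding k_def by (intro arg_cong2[of _ _ _ _ "(+)"] sum.cong) auto
  qed
  define h where "h \<epsilon> = k \<epsilon> (f \<epsilon>) + \<epsilon> a * \<bar>f \<epsilon> (x a)\<bar>" for \<epsilon>
  define h' where "h' \<epsilon> = k \<epsilon> (g \<epsilon>) + \<epsilon> a * g \<epsilon> (x a)" for \<epsilon>
  have pair: "h \<epsilon> + h (\<sigma> \<epsilon>) \<le> h' \<epsilon> + h' (\<sigma> \<epsilon>)" if "\<epsilon> \<in> signs I" for \<epsilon>
    using signsD[OF that aI] unfolding h_def h'_def g_def k\<sigma> \<sigma>a \<sigma>(2)[OF that] by auto
  have "(\<Sum>\<epsilon>\<in>signs I. h \<epsilon>) + (\<Sum>\<epsilon>\<in>signs I. h (\<sigma> \<epsilon>)) \<le> (\<Sum>\<epsilon>\<in>signs I. h' \<epsilon>) + (\<Sum>\<epsilon>\<in>signs I. h' (\<sigma> \<epsilon>))"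
    using sum_mono[OF pair] by (simp add: sum.distrib)
  then have "(\<Sum>\<epsilon>\<in>signs I. h \<epsilon>) \<le> (\<Sum>\<epsilon>\<in>signs I. h' \<epsilon>)"
    using sum_signs_flip[of I s h] sum_signs_flip[of I s h'] s by (simp add: \<sigma>_def)
  also have "\<dots> = (\<Sum>\<epsilon>\<in>signs I. (\<Sum>i\<in>A. \<epsilon> i * \<bar>g \<epsilon> (x i)\<bar>) + (\<Sum>i\<in>insert a B. \<epsilon> i * g \<epsilon> (x i)))"
    using finB aB by (simp add: h'_def k_def algebra_simps)
  also have "\<dots> \<le> (\<Sum>\<epsilon>\<in>signs I. norm (\<Sum>i\<in>A \<union> insert a B. \<epsilon> i *\<^sub>R x i))"
    using insert.prems insert.hyps \<sigma> by (intro insert.IH) (auto simp: g_def)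
  finally show ?case
    using insert.hyps by (simp add: h_def k_def algebra_simps)
qed

text \<open>If every sign pattern failed for some functional, then choosing these functionals would make the
  left-hand side of the contraction principle exceed its right-hand side.\<close>

lemma balanced_signs:
  fixes x :: "nat \<Rightarrow> 'a::real_normed_vector"
  assumes "finite I" "J \<subseteq> I"
  shows "\<exists>\<epsilon>\<in>signs I. \<forall>f\<in>dual_ball. \<bar>\<Sum>i\<in>J. \<epsilon> i * \<bar>f (x i)\<bar>\<bar> \<le> 2 * ravg I x J"
proof (rule ccontr)
  assume no: "\<not> ?thesis"
  define R where "R = ravg I x J"
  define s :: "nat \<Rightarrow> real" where "s i = -1" for i
  define d where "d \<epsilon> f = (\<Sum>i\<in>J. \<epsilon> i * \<bar>f (x i)\<bar>)" for \<epsilon> and f :: "'a \<Rightarrow> real"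
  have d_flip: "d (flip I s \<epsilon>) f = - d \<epsilon> f" for \<epsilon> f
    unfolding d_def sum_negf[symmetric] using assms by (intro sum.cong) (auto simp: flip_def s_def)
  \<comment> \<open>The zero functional as default value keeps all values \<open>d \<epsilon> (f \<epsilon>)\<close> nonnegative, so that
    each pair of opposite sign patterns contributes more than \<open>2 * R\<close>.\<close>
  define f where "f \<epsilon> = (if \<exists>f\<in>dual_ball. d \<epsilon> f > 2 * R then SOME f. f \<in> dual_ball \<and> d \<epsilon> f > 2 * R else (\<lambda>_. 0))" for \<epsilon>
  have all: "f \<epsilon> \<in> dual_ball \<and> 0 \<le> d \<epsilon> (f \<epsilon>) \<and> (\<phi> \<in> dual_ball \<longrightarrow> 2 * R < d \<epsilon> \<phi> \<longrightarrow> 2 * R < d \<epsilon> (f \<epsilon>))" for \<epsilon> \<phi>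
  proof (cases "\<exists>f\<in>dual_ball. d \<epsilon> f > 2 * R")
    case True
    then have "\<exists>f. f \<in> dual_ball \<and> d \<epsilon> f > 2 * R" by blast
    moreover have "0 \<le> R" by (simp add: R_def ravg_nonneg)
    ultimately show ?thesis using True someI_ex[of "\<lambda>f. f \<in> dual_ball \<and> d \<epsilon> f > 2 * R"] by (auto simp: f_def)
  next
    case False
    then show ?thesis by (auto simp: f_def zero_in_dual_ball d_def)
  qed
  then have f: "f \<epsilon> \<in> dual_ball" "d \<epsilon> (f \<epsilon>) \<ge> 0" "\<phi> \<in> dual_ball \<Longrightarrow> d \<epsilon> \<phi> > 2 * R \<Longrightarrow> d \<epsilon> (f \<epsilon>) > 2 * R" for \<epsilon> \<phi>
    by blast+
  have big: "2 * R < d \<epsilon> (f \<epsilon>) + d (flip I s \<epsilon>) (f (flip I s \<epsilon>))" if \<epsilon>: "\<epsilon> \<in> signs I" for \<epsilon>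
  proof -
    have "\<exists>\<phi>\<in>dual_ball. \<bar>d \<epsilon> \<phi>\<bar> > 2 * R"
      using no \<epsilon> by (auto simp: d_def R_def not_le)
    then obtain \<phi> where \<phi>: "\<phi> \<in> dual_ball" "\<bar>d \<epsilon> \<phi>\<bar> > 2 * R" by blast
    then consider "d \<epsilon> \<phi> > 2 * R" | "d (flip I s \<epsilon>) \<phi> > 2 * R" by (auto simp: d_flip abs_if split: if_splits)
    then show ?thesis using f(3)[OF \<phi>(1)] f(2)[of \<epsilon>] f(2)[of "flip I s \<epsilon>"] by cases (smt (verit))+
  qed
  have "2 * (2 ^ card I * R) = (\<Sum>\<epsilon>\<in>signs I. 2 * R)" using assms by (simp add: card_signs)
  also have "\<dots> < (\<Sum>\<epsilon>\<in>signs I. d \<epsilon> (f \<epsilon>) + d (flip I s \<epsilon>) (f (flip I s \<epsilon>)))"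
    using big assms by (intro sum_strict_mono) (auto simp: finite_signs signs_nonempty)
  also have "\<dots> = 2 * (\<Sum>\<epsilon>\<in>signs I. d \<epsilon> (f \<epsilon>))"
    using sum_signs_flip[of I s "\<lambda>\<epsilon>. d \<epsilon> (f \<epsilon>)"] by (simp add: s_def sum.distrib)
  also have "(\<Sum>\<epsilon>\<in>signs I. d \<epsilon> (f \<epsilon>)) \<le> (\<Sum>\<epsilon>\<in>signs I. norm (\<Sum>i\<in>J. \<epsilon> i *\<^sub>R x i))"
    using contraction_abs[of I J "{}" f x] assms f(1) finite_subset by (auto simp: d_def)
  also have "\<dots> \<le> 2 ^ card I * R" using sum_norm_le_ravg[OF assms(1)] by (simp add: R_def)
  finally show False by simp
qed

text \<open>Balanced signs split \<open>J\<close> into two parts that carry about half of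
  \<open>\<Sum>i\<in>J. \<bar>f (x i)\<bar>\<close> each, simultaneously for all functionals \<open>f\<close>; the larger part is
  kept.\<close>

lemma max_signed_halving:
  assumes "finite I" "J \<subseteq> I"
  obtains J' where "J' \<subseteq> J" "card J \<le> 2 * card J'" "max_signed x J' \<le> max_signed x J / 2 + ravg I x J"
proof -
  have fin: "finite J" using assms finite_subset by blast
  obtain \<epsilon> where \<epsilon>: "\<epsilon> \<in> signs I" "\<And>f. f \<in> dual_ball \<Longrightarrow> \<bar>\<Sum>i\<in>J. \<epsilon> i * \<bar>f (x i)\<bar>\<bar> \<le> 2 * ravg I x J"
    using balanced_signs[OF assms] by blast
  define part where "part c = {i\<in>J. \<epsilon> i = c}" for c
  have bound: "max_signed x (part c) \<le> max_signed x J / 2 + ravg I x J" if c: "c = 1 \<or> c = -1" for c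
  proof -
    obtain f where f: "f \<in> dual_ball" "max_signed x (part c) = (\<Sum>i\<in>part c. \<bar>f (x i)\<bar>)"
      using max_signed_functional[of "part c"] fin by (auto simp: part_def)
    have "(\<Sum>i\<in>part c. \<bar>f (x i)\<bar>) = (\<Sum>i\<in>J. (\<bar>f (x i)\<bar> + c * (\<epsilon> i * \<bar>f (x i)\<bar>)) / 2)"
      unfolding part_def sum.inter_filter[OF fin]
      by (intro sum.cong refl) (use c signsD[OF \<epsilon>(1)] assms in \<open>force simp: subset_eq\<close>)
    also have "\<dots> = ((\<Sum>i\<in>J. \<bar>f (x i)\<bar>) + c * (\<Sum>i\<in>J. \<epsilon> i * \<bar>f (x i)\<bar>)) / 2"
      by (simp add: sum.distrib sum_divide_distrib[symmetric] sum_distrib_left)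
    also have "\<dots> \<le> (max_signed x J + 2 * ravg I x J) / 2"
      using \<epsilon>(2)[OF f(1)] sum_abs_functional_le_max_signed[OF fin f(1), of x] c by (auto simp: abs_if split: if_splits)
    finally show ?thesis using f by simp
  qed
  have "J = part 1 \<union> part (-1)" using signsD[OF \<epsilon>(1)] assms by (auto simp: part_def)
  then have "card J \<le> card (part 1) + card (part (-1))" by (metis card_Un_le)
  then have "card J \<le> 2 * card (part 1) \<or> card J \<le> 2 * card (part (-1))" by linarith
  moreover have "part c \<subseteq> J" for c by (auto simp: part_def)
  ultimately show thesis using that bound by blast
qed

section \<open>Exhaustion by disjoint blocks\<close>

text \<open>Call a block \<open>B\<close> heavy if \<open>F B \<ge> T * card B powr a\<close>, and take a maximal disjoint
  family of heavy blocks. By \<open>blocks\<close> and \<open>large\<close> its union cannot fill half of \<open>S\<close>, and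
  by maximality the rest of \<open>S\<close> contains no heavy block.\<close>

lemma exhaustion:
  fixes F :: "nat set \<Rightarrow> real"
  assumes fin: "finite S" and T: "0 \<le> T" and D: "0 \<le> D" and a: "0 \<le> a"
    and mono: "\<And>U. U \<subseteq> S \<Longrightarrow> F U \<le> F S"
    and blocks: "\<And>P. P \<subseteq> Pow S \<Longrightarrow> P \<noteq> {} \<Longrightarrow> disjoint P \<Longrightarrow> {} \<notin> P \<Longrightarrow>
       (\<And>B. B \<in> P \<Longrightarrow> T * card B powr a \<le> F B) \<Longrightarrow> T * card (\<Union>P) powr a \<le> D * F (\<Union>P)"
    and large: "D * F S < T * (card S / 2) powr a"
  obtains J where "J \<subseteq> S" "card S \<le> 2 * card J" "\<And>B. B \<subseteq> J \<Longrightarrow> B \<noteq> {} \<Longrightarrow> F B < T * card B powr a"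
proof -
  define \<P> where "\<P> = {P. P \<subseteq> Pow S \<and> disjoint P \<and> {} \<notin> P \<and> (\<forall>B\<in>P. T * card B powr a \<le> F B)}"
  have "\<P> \<subseteq> Pow (Pow S)" by (auto simp: \<P>_def)
  then have "finite \<P>" using fin finite_subset by blast
  moreover have "{} \<in> \<P>" by (simp add: \<P>_def disjoint_def)
  ultimately have "Max (card ` \<P>) \<in> card ` \<P>" by (intro Max_in) auto
  then obtain P where P: "P \<in> \<P>" "Max (card ` \<P>) = card P" by blast
  then have max: "card Q \<le> card P" if "Q \<in> \<P>" for Q
    using Max_ge[of "card ` \<P>" "card Q"] \<open>finite \<P>\<close> that by auto
  have PS: "P \<subseteq> Pow S" using P(1) by (simp add: \<P>_def)
  then have finP: "finite P" using fin finite_subset by blast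
  have US: "\<Union>P \<subseteq> S" using PS by auto
  have finU: "finite (\<Union>P)" using finite_subset[OF US fin] .
  have small: "2 * card (\<Union>P) \<le> card S"
  proof (rule ccontr)
    assume "\<not> ?thesis"
    then have less: "card S < 2 * card (\<Union>P)" by simp
    then have "P \<noteq> {}" by auto
    have "T * (card S / 2) powr a \<le> T * card (\<Union>P) powr a"
      using less T a by (intro mult_left_mono powr_mono2) auto
    also have "\<dots> \<le> D * F (\<Union>P)" using P(1) \<open>P \<noteq> {}\<close> by (intro blocks) (auto simp: \<P>_def)
    also have "\<dots> \<le> D * F S" using mono[OF US] D by (intro mult_left_mono)
    finally show False using large by simp
  qed
  show thesis
  proof (rule that[of "S - \<Union>P"])
    show "card S \<le> 2 * card (S - \<Union>P)"
      using small US finU by (simp add: card_Diff_subset)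
    show "F B < T * card B powr a" if B: "B \<subseteq> S - \<Union>P" "B \<noteq> {}" for B
    proof (rule ccontr)
      assume "\<not> ?thesis"
      then have "insert B P \<in> \<P>" using P(1) B by (auto simp: \<P>_def disjoint_def)
      moreover have "B \<notin> P" using B by auto
      ultimately show False using max[of "insert B P"] finP by simp
    qed
  qed auto
qed

section \<open>Lower estimates for disjoint blocks\<close>

text \<open>Cotype \<open>1 / a\<close>, tested against weights \<open>m\<close>. In this quadratic form the inequality can be
  averaged over further random signs, and cotype \<open>\<infinity>\<close> is simply the case \<open>a = 0\<close>.\<close>

definition weighted_cotype :: "'a::real_normed_vector itself \<Rightarrow> real \<Rightarrow> real \<Rightarrow> bool" where
  "weighted_cotype _ a D \<longleftrightarrow> (\<forall>n (y :: nat \<Rightarrow> 'a) m. (\<forall>k<n. 0 < m k) \<longrightarrow>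
     (\<Sum>k<n. m k powr (1 - 2 * a) * (norm (y k))\<^sup>2)
       \<le> D\<^sup>2 * (\<Sum>k<n. m k) powr (1 - 2 * a) * (rademacher_avg n y)\<^sup>2)"

lemma weighted_cotype_infinity: "weighted_cotype TYPE('a::real_normed_vector) 0 1"
  unfolding weighted_cotype_def
proof (intro allI impI)
  fix n :: nat and m :: "nat \<Rightarrow> real" and y :: "nat \<Rightarrow> 'a"
  assume m: "\<forall>k<n. 0 < (m k :: real)"
  have "(\<Sum>k<n. m k powr (1 - 2 * 0) * (norm (y k))\<^sup>2) \<le> (\<Sum>k<n. m k * (rademacher_avg n y)\<^sup>2)"
  proof (rule sum_mono)
    fix k assume k: "k \<in> {..<n}"
    have "(norm (y k))\<^sup>2 \<le> (rademacher_avg n y)\<^sup>2"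
      using norm_le_ravg[of "{..<n}" "{..<n}" k y] k by (intro power_mono) (auto simp: rademacher_avg_eq_ravg)
    moreover have "m k > 0" using k m by simp
    ultimately show "m k powr (1 - 2 * 0) * (norm (y k))\<^sup>2 \<le> m k * (rademacher_avg n y)\<^sup>2" by simp
  qed
  also have "\<dots> = 1\<^sup>2 * (\<Sum>k<n. m k) powr (1 - 2 * 0) * (rademacher_avg n y)\<^sup>2"
  proof -
    have "0 \<le> (\<Sum>k<n. m k)" by (intro sum_nonneg) (use m in \<open>auto intro: less_imp_le\<close>)
    then show ?thesis by (simp add: sum_distrib_right)
  qed
  finally show "(\<Sum>k<n. m k powr (1 - 2 * 0) * (norm (y k))\<^sup>2)
      \<le> 1\<^sup>2 * (\<Sum>k<n. m k) powr (1 - 2 * 0) * (rademacher_avg n y)\<^sup>2" .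
qed

text \<open>Hoelder's inequality with exponents \<open>q / 2\<close> and its conjugate, obtained by summing Young's
  inequality for the normalised terms \<open>u k\<close>.\<close>

lemma weighted_power_mean:
  fixes m t :: "nat \<Rightarrow> real"
  assumes q: "2 < q" and m: "\<And>k. k < n \<Longrightarrow> 0 < m k" and t: "\<And>k. k < n \<Longrightarrow> 0 \<le> t k"
  shows "(\<Sum>k<n. m k powr (1 - 2 / q) * (t k)\<^sup>2)
    \<le> (\<Sum>k<n. m k) powr (1 - 2 / q) * ((\<Sum>k<n. t k powr q) powr (1 / q))\<^sup>2"
proof (cases "(\<Sum>k<n. t k powr q) = 0")
  case True
  then have "t k = 0" if "k < n" for k
    using that by (subst (asm) sum_nonneg_eq_0_iff) auto
  then show ?thesis by (simp add: True)
next
  case False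
  define S where "S = (\<Sum>k<n. t k powr q)"
  define N where "N = (\<Sum>k<n. m k)"
  have S: "S > 0" using False sum_nonneg[of "{..<n}" "\<lambda>k. t k powr q"] by (simp add: S_def)
  have "n \<noteq> 0" using False by (cases n) auto
  then have N: "N > 0" unfolding N_def using m by (intro sum_pos) auto
  define L where "L = (S / N) powr (2 / q)"
  have L: "L > 0" using S N by (simp add: L_def)
  define u where "u k = (t k)\<^sup>2 * m k powr (- 2 / q) / L" for k
  have u: "m k * u k \<le> t k powr q * N / S * (2 / q) + m k * (1 - 2 / q)" if k: "k < n" for k
  proof -
    have mk: "m k > 0" using m k by simp
    have tk: "t k \<ge> 0" using t k by simp
    have t2: "((t k)\<^sup>2) powr (q / 2) = t k powr q"
    proof (cases "t k = 0")
      case False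
      then have "(t k)\<^sup>2 = t k powr 2" using tk by (simp add: powr_numeral)
      then show ?thesis by (simp add: powr_powr)
    qed (use q in simp)
    have "u k powr (q / 2) = t k powr q * m k powr (- 1) / (S / N)"
      using mk tk S N q by (simp add: u_def L_def powr_mult powr_divide powr_powr t2)
    then have up: "u k powr (q / 2) = t k powr q * N / S / m k"
      using mk by (simp add: powr_minus_divide)
    have "u k * 1 \<le> u k powr (q/2) / (q/2) + 1 powr (1 / (1 - 2/q)) / (1 / (1 - 2/q))"
      using q L tk by (intro Youngs_inequality) (auto simp: u_def field_simps)
    also have "\<dots> = t k powr q * N / S / m k * (2 / q) + (1 - 2/q)" by (simp add: up)
    finally have "m k * u k \<le> m k * (t k powr q * N / S / m k * (2 / q) + (1 - 2/q))"
      using mk by simp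
    then show ?thesis using mk by (simp add: distrib_left)
  qed
  have mu: "m k powr (1 - 2 / q) * (t k)\<^sup>2 = L * (m k * u k)" if "k < n" for k
  proof -
    have "m k powr (1 - 2 / q) = m k * m k powr (- 2 / q)"
      using m[OF that] by (simp add: powr_diff powr_minus_divide)
    then show ?thesis using L by (simp add: u_def)
  qed
  have "(\<Sum>k<n. m k powr (1 - 2 / q) * (t k)\<^sup>2) = L * (\<Sum>k<n. m k * u k)"
    by (simp add: mu sum_distrib_left)
  also have "\<dots> \<le> L * (\<Sum>k<n. t k powr q * N / S * (2 / q) + m k * (1 - 2 / q))"
    using u L by (intro mult_left_mono sum_mono) auto
  also have "(\<Sum>k<n. t k powr q * N / S * (2 / q) + m k * (1 - 2 / q)) = S * N / S * (2 / q) + N * (1 - 2 / q)"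
    by (simp add: sum.distrib S_def N_def sum_distrib_right sum_divide_distrib)
  also have "\<dots> = N" using S by (simp add: field_simps)
  also have "L * N = N powr (1 - 2 / q) * (S powr (1 / q))\<^sup>2"
  proof -
    have "(S powr (1 / q))\<^sup>2 = S powr (2 / q)" by (simp add: power2_eq_square powr_add[symmetric])
    moreover have "N powr (1 - 2 / q) = N / N powr (2 / q)" using N by (simp add: powr_diff)
    ultimately show ?thesis using S N by (simp add: L_def powr_divide)
  qed
  finally show ?thesis by (simp add: S_def N_def)
qed

lemma weighted_cotype_of_cotype:
  assumes q: "2 < q" and cot: "has_cotype TYPE('a::real_normed_vector) (ereal q)"
  obtains D where "D > 0" "weighted_cotype TYPE('a) (1 / q) D"
proof -
  obtain C where C: "\<And>n (y :: nat \<Rightarrow> 'a). (\<Sum>i<n. norm (y i) powr q) powr (1 / q) \<le> C * rademacher_avg n y"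
    using cot by (auto simp: has_cotype_def)
  define D where "D = max C 1"
  have "weighted_cotype TYPE('a) (1 / q) D"
    unfolding weighted_cotype_def
  proof (intro allI impI)
    fix n :: nat and m :: "nat \<Rightarrow> real" and y :: "nat \<Rightarrow> 'a"
    assume m: "\<forall>k<n. 0 < (m k :: real)"
    have "C * rademacher_avg n y \<le> D * rademacher_avg n y"
      by (intro mult_right_mono) (auto simp: D_def rademacher_avg_eq_ravg ravg_nonneg)
    with C[where n=n and y=y] have "(\<Sum>i<n. norm (y i) powr q) powr (1 / q) \<le> D * rademacher_avg n y"
      by (rule order_trans)
    then have "((\<Sum>i<n. norm (y i) powr q) powr (1 / q))\<^sup>2 \<le> (D * rademacher_avg n y)\<^sup>2"
      by (intro power_mono) auto
    then have "(\<Sum>k<n. m k) powr (1 - 2 / q) * ((\<Sum>i<n. norm (y i) powr q) powr (1 / q))\<^sup>2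
       \<le> (\<Sum>k<n. m k) powr (1 - 2 / q) * (D * rademacher_avg n y)\<^sup>2"
      by (intro mult_left_mono) auto
    with weighted_power_mean[of q n m "\<lambda>k. norm (y k)"] q m
    show "(\<Sum>k<n. m k powr (1 - 2 * (1 / q)) * (norm (y k))\<^sup>2)
      \<le> D\<^sup>2 * (\<Sum>k<n. m k) powr (1 - 2 * (1 / q)) * (rademacher_avg n y)\<^sup>2"
      by (simp add: power_mult_distrib mult_ac)
  qed
  then show thesis using that[of D] by (simp add: D_def)
qed

lemma enumerate_blocks:
  fixes P :: "nat set set"
  assumes "finite P" "disjoint P" "finite (\<Union>P)"
  obtains n e b where "bij_betw e {..<n::nat} P" "\<And>k i. k < n \<Longrightarrow> i \<in> e k \<Longrightarrow> b i = k"
    "\<And>g :: nat \<Rightarrow> 'b::comm_monoid_add. (\<Sum>i\<in>\<Union>P. g i) = (\<Sum>k<n. \<Sum>i\<in>e k. g i)"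
    "card (\<Union>P) = (\<Sum>k<n. card (e k))"
proof -
  obtain e where e: "bij_betw e {..<card P} P"
    using ex_bij_betw_nat_finite[OF assms(1)] by (auto simp: atLeast0LessThan)
  have P: "\<Union>P = (\<Union>k<card P. e k)" using e by (auto simp: bij_betw_def)
  have disj: "e k \<inter> e l = {}" if "k < card P" "l < card P" "k \<noteq> l" for k l
  proof -
    have "e k \<noteq> e l" using e that by (auto simp: bij_betw_def inj_on_def)
    moreover have "e k \<in> P" "e l \<in> P" using e that by (auto simp: bij_betw_def)
    ultimately show ?thesis using assms(2) by (auto simp: disjoint_def)
  qed
  have fin: "finite (e k)" if "k < card P" for k
    using assms(3) that e by (auto simp: bij_betw_def intro: finite_subset[of "e k" "\<Union>P"])
  define b where "b i = (THE k. k < card P \<and> i \<in> e k)" for i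
  have "b i = k" if "k < card P" "i \<in> e k" for k i
    unfolding b_def using that disj by (intro the_equality) blast+
  moreover have "(\<Sum>i\<in>\<Union>P. g i) = (\<Sum>k<card P. \<Sum>i\<in>e k. g i)" for g :: "nat \<Rightarrow> 'b"
    unfolding P using fin disj by (intro sum.UNION_disjoint) auto
  moreover have "card (\<Union>P) = (\<Sum>k<card P. card (e k))"
    unfolding P using fin disj by (intro card_UN_disjoint) auto
  ultimately show thesis using that e by blast
qed

text \<open>The cotype inequality is applied to the block sums for each choice of the signs inside the blocks
  and then averaged over these signs.\<close>

lemma ravg_blocks:
  fixes x :: "nat \<Rightarrow> 'a::real_normed_vector"
  assumes cot: "weighted_cotype TYPE('a) a D" and I: "finite I" and P: "disjoint P" "{} \<notin> P" "\<Union>P \<subseteq> I"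
  shows "(\<Sum>B\<in>P. card B powr (1 - 2 * a) * (ravg I x B)\<^sup>2)
    \<le> D\<^sup>2 * card (\<Union>P) powr (1 - 2 * a) * (ravg I x (\<Union>P))\<^sup>2"
proof -
  have "P \<subseteq> Pow I" using P by auto
  then have finP: "finite P" using I finite_subset by blast
  have finU: "finite (\<Union>P)" using finite_subset[OF P(3) I] .
  obtain n e b where e: "bij_betw e {..<n::nat} P" and b: "\<And>k i. k < n \<Longrightarrow> i \<in> e k \<Longrightarrow> b i = k"
    and sum: "\<And>g :: nat \<Rightarrow> 'a. (\<Sum>i\<in>\<Union>P. g i) = (\<Sum>k<n. \<Sum>i\<in>e k. g i)"
    and card: "card (\<Union>P) = (\<Sum>k<n. card (e k))"
    by (rule enumerate_blocks[OF finP P(1) finU, where 'b='a]) blast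
  have eP: "e k \<in> P" if "k < n" for k using e that by (auto simp: bij_betw_def)
  have pos: "0 < card (e k)" if "k < n" for k
    using eP[OF that] P finite_subset[of "e k", OF _ finU] by (auto simp: card_gt_0_iff)
  define m where "m k = real (card (e k))" for k
  have N: "(\<Sum>k<n. m k) = card (\<Union>P)" by (simp add: m_def card)
  define N' where "N' = D\<^sup>2 * card (\<Union>P) powr (1 - 2 * a)"
  define y where "y \<epsilon> k = (\<Sum>i\<in>e k. \<epsilon> i *\<^sub>R x i)" for \<epsilon> k
  have pointwise: "(\<Sum>k<n. m k powr (1 - 2 * a) * (norm (y \<epsilon> k))\<^sup>2) \<le> N' * (rademacher_avg n (y \<epsilon>))\<^sup>2" for \<epsilon>
    using cot pos unfolding weighted_cotype_def N'_def N[symmetric] by (simp add: m_def)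
  \<comment> \<open>Averaging over the signs inside the blocks absorbs the signs in front of the blocks.\<close>
  have absorb: "(\<Sum>\<epsilon>\<in>signs I. (norm (\<Sum>k<n. \<theta> k *\<^sub>R y \<epsilon> k))\<^sup>2) = 2 ^ card I * (ravg I x (\<Union>P))\<^sup>2"
    if \<theta>: "\<theta> \<in> signs {..<n}" for \<theta>
  proof -
    define s where "s i = (if b i < n then \<theta> (b i) else 1)" for i
    have s: "s i = -1 \<or> s i = 1" for i using signsD[OF \<theta>] by (auto simp: s_def)
    have "(\<Sum>k<n. \<theta> k *\<^sub>R y \<epsilon> k) = (\<Sum>i\<in>\<Union>P. flip I s \<epsilon> i *\<^sub>R x i)" for \<epsilon>
    proof -
      have "\<theta> k *\<^sub>R y \<epsilon> k = (\<Sum>i\<in>e k. flip I s \<epsilon> i *\<^sub>R x i)" if "k < n" for k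
        unfolding y_def scaleR_sum_right using eP[OF that] P(3) b[OF that] that
        by (intro sum.cong) (auto simp: flip_def s_def)
      then show ?thesis by (simp add: sum)
    qed
    then have "(\<Sum>\<epsilon>\<in>signs I. (norm (\<Sum>k<n. \<theta> k *\<^sub>R y \<epsilon> k))\<^sup>2)
        = (\<Sum>\<epsilon>\<in>signs I. (norm (\<Sum>i\<in>\<Union>P. flip I s \<epsilon> i *\<^sub>R x i))\<^sup>2)" by simp
    also have "\<dots> = (\<Sum>\<epsilon>\<in>signs I. (norm (\<Sum>i\<in>\<Union>P. \<epsilon> i *\<^sub>R x i))\<^sup>2)"
      by (rule sum_signs_flip[of I s "\<lambda>\<epsilon>. (norm (\<Sum>i\<in>\<Union>P. \<epsilon> i *\<^sub>R x i))\<^sup>2"]) (rule s)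
    finally show ?thesis by (simp add: ravg_square)
  qed
  have "2 ^ n * (\<Sum>\<epsilon>\<in>signs I. (rademacher_avg n (y \<epsilon>))\<^sup>2)
      = (\<Sum>\<epsilon>\<in>signs I. \<Sum>\<theta>\<in>signs {..<n}. (norm (\<Sum>k<n. \<theta> k *\<^sub>R y \<epsilon> k))\<^sup>2)"
    by (simp add: rademacher_avg_eq_ravg sum_distrib_left ravg_square[of "{..<n}", simplified])
  also have "\<dots> = (\<Sum>\<theta>\<in>signs {..<n}. \<Sum>\<epsilon>\<in>signs I. (norm (\<Sum>k<n. \<theta> k *\<^sub>R y \<epsilon> k))\<^sup>2)"
    by (rule sum.swap)
  also have "\<dots> = 2 ^ n * (2 ^ card I * (ravg I x (\<Union>P))\<^sup>2)"
    by (simp add: absorb card_signs)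
  finally have rad: "(\<Sum>\<epsilon>\<in>signs I. (rademacher_avg n (y \<epsilon>))\<^sup>2) = 2 ^ card I * (ravg I x (\<Union>P))\<^sup>2" by simp
  have "2 ^ card I * (\<Sum>B\<in>P. card B powr (1 - 2 * a) * (ravg I x B)\<^sup>2)
      = 2 ^ card I * (\<Sum>k<n. m k powr (1 - 2 * a) * (ravg I x (e k))\<^sup>2)"
    using sum.reindex_bij_betw[OF e, of "\<lambda>B. card B powr (1 - 2 * a) * (ravg I x B)\<^sup>2"] by (simp add: m_def)
  also have "\<dots> = (\<Sum>k<n. \<Sum>\<epsilon>\<in>signs I. m k powr (1 - 2 * a) * (norm (y \<epsilon> k))\<^sup>2)"
    by (simp add: y_def sum_distrib_left[symmetric] ravg_square[symmetric] mult.left_commute)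
  also have "\<dots> = (\<Sum>\<epsilon>\<in>signs I. \<Sum>k<n. m k powr (1 - 2 * a) * (norm (y \<epsilon> k))\<^sup>2)"
    by (rule sum.swap)
  also have "\<dots> \<le> (\<Sum>\<epsilon>\<in>signs I. N' * (rademacher_avg n (y \<epsilon>))\<^sup>2)"
    by (intro sum_mono pointwise)
  also have "\<dots> = 2 ^ card I * (N' * (ravg I x (\<Union>P))\<^sup>2)"
    by (simp add: sum_distrib_left[symmetric] rad)
  finally show ?thesis by (simp add: N'_def)
qed

text \<open>The same estimate for the maxima: the vectors to which cotype is applied are the extremal signed
  sums of the blocks, and any further signed sum of these is a signed sum over the union.\<close>

lemma max_signed_blocks:
  fixes x :: "nat \<Rightarrow> 'a::real_normed_vector"
  assumes cot: "weighted_cotype TYPE('a) a D" and P: "disjoint P" "{} \<notin> P" and finU: "finite (\<Union>P)"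
  shows "(\<Sum>B\<in>P. card B powr (1 - 2 * a) * (max_signed x B)\<^sup>2)
    \<le> D\<^sup>2 * card (\<Union>P) powr (1 - 2 * a) * (max_signed x (\<Union>P))\<^sup>2"
proof -
  have finP: "finite P" using finU by (rule finite_UnionD)
  obtain n e b where e: "bij_betw e {..<n::nat} P" and b: "\<And>k i. k < n \<Longrightarrow> i \<in> e k \<Longrightarrow> b i = k"
    and sum: "\<And>g :: nat \<Rightarrow> 'a. (\<Sum>i\<in>\<Union>P. g i) = (\<Sum>k<n. \<Sum>i\<in>e k. g i)"
    and card: "card (\<Union>P) = (\<Sum>k<n. card (e k))"
    by (rule enumerate_blocks[OF finP P(1) finU, where 'b='a]) blast
  have eP: "e k \<in> P" if "k < n" for k using e that by (auto simp: bij_betw_def)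
  have fin: "finite (e k)" if "k < n" for k
    using eP[OF that] finite_subset[of "e k", OF _ finU] by auto
  have pos: "0 < card (e k)" if "k < n" for k
    using eP[OF that] P fin[OF that] by (auto simp: card_gt_0_iff)
  define m where "m k = real (card (e k))" for k
  have N: "(\<Sum>k<n. m k) = card (\<Union>P)" by (simp add: m_def card)
  have "\<forall>k. \<exists>\<theta>. k < n \<longrightarrow> \<theta> \<in> signs (e k) \<and> max_signed x (e k) = norm (\<Sum>i\<in>e k. \<theta> i *\<^sub>R x i)"
    using max_signed_attained fin by metis
  then obtain \<theta> where \<theta>: "\<And>k. k < n \<Longrightarrow> \<theta> k \<in> signs (e k)"
    "\<And>k. k < n \<Longrightarrow> max_signed x (e k) = norm (\<Sum>i\<in>e k. \<theta> k i *\<^sub>R x i)"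
    by metis
  define y where "y k = (\<Sum>i\<in>e k. \<theta> k i *\<^sub>R x i)" for k
  have le: "norm (\<Sum>k<n. \<eta> k *\<^sub>R y k) \<le> max_signed x (\<Union>P)" if \<eta>: "\<eta> \<in> signs {..<n}" for \<eta>
  proof -
    have "\<eta> k *\<^sub>R y k = (\<Sum>i\<in>e k. (\<eta> (b i) * \<theta> (b i) i) *\<^sub>R x i)" if "k < n" for k
      unfolding y_def scaleR_sum_right using b[OF that] by (intro sum.cong) auto
    then have "(\<Sum>k<n. \<eta> k *\<^sub>R y k) = (\<Sum>i\<in>\<Union>P. (\<eta> (b i) * \<theta> (b i) i) *\<^sub>R x i)"
      by (simp add: sum)
    also have "norm \<dots> \<le> max_signed x (\<Union>P)"
    proof (rule norm_le_max_signed[OF finU])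
      fix i assume "i \<in> \<Union>P"
      then obtain k where k: "k < n" "i \<in> e k" using e by (auto simp: bij_betw_def)
      then have "\<eta> k = -1 \<or> \<eta> k = 1" "\<theta> k i = -1 \<or> \<theta> k i = 1"
        using signsD[OF \<eta>] signsD[OF \<theta>(1)] by auto
      then show "\<eta> (b i) * \<theta> (b i) i = -1 \<or> \<eta> (b i) * \<theta> (b i) i = 1" using b[OF k] by auto
    qed
    finally show ?thesis .
  qed
  have "2 ^ n * (rademacher_avg n y)\<^sup>2 = (\<Sum>\<eta>\<in>signs {..<n}. (norm (\<Sum>k<n. \<eta> k *\<^sub>R y k))\<^sup>2)"
    using ravg_square[of "{..<n}" y "{..<n}"] by (simp add: rademacher_avg_eq_ravg)
  also have "\<dots> \<le> (\<Sum>\<eta>\<in>signs {..<n}. (max_signed x (\<Union>P))\<^sup>2)"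
    using le by (intro sum_mono power_mono) auto
  finally have rad: "(rademacher_avg n y)\<^sup>2 \<le> (max_signed x (\<Union>P))\<^sup>2" by (simp add: card_signs)
  have "(\<Sum>B\<in>P. card B powr (1 - 2 * a) * (max_signed x B)\<^sup>2) = (\<Sum>k<n. m k powr (1 - 2 * a) * (norm (y k))\<^sup>2)"
    using sum.reindex_bij_betw[OF e, of "\<lambda>B. card B powr (1 - 2 * a) * (max_signed x B)\<^sup>2"] \<theta>(2)
    by (simp add: m_def y_def)
  also have "\<dots> \<le> D\<^sup>2 * card (\<Union>P) powr (1 - 2 * a) * (rademacher_avg n y)\<^sup>2"
    using cot pos unfolding weighted_cotype_def N[symmetric] by (simp add: m_def)
  also have "\<dots> \<le> D\<^sup>2 * card (\<Union>P) powr (1 - 2 * a) * (max_signed x (\<Union>P))\<^sup>2"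
    using rad by (intro mult_left_mono) auto
  finally show ?thesis .
qed

text \<open>The exponent \<open>1 - 2 * a\<close> of the weights is chosen so that the contribution of a heavy block
  is at least \<open>T\<^sup>2 * card B\<close>; these contributions add up to \<open>T\<^sup>2 * card (\<Union>P)\<close>.\<close>

lemma heavy_blocks:
  fixes F :: "nat set \<Rightarrow> real"
  assumes P: "disjoint P" "{} \<notin> P" "P \<noteq> {}" and finU: "finite (\<Union>P)"
    and T: "0 \<le> T" and D: "0 \<le> D" and F: "0 \<le> F (\<Union>P)"
    and quad: "(\<Sum>B\<in>P. card B powr (1 - 2 * a) * (F B)\<^sup>2) \<le> D\<^sup>2 * card (\<Union>P) powr (1 - 2 * a) * (F (\<Union>P))\<^sup>2"
    and heavy: "\<And>B. B \<in> P \<Longrightarrow> T * card B powr a \<le> F B"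
  shows "T * card (\<Union>P) powr a \<le> D * F (\<Union>P)"
proof -
  define N where "N = real (card (\<Union>P))"
  have fin: "finite B" if "B \<in> P" for B using that finite_subset[of B, OF _ finU] by auto
  have pos: "card B > 0" if "B \<in> P" for B using that fin[OF that] P by (auto simp: card_gt_0_iff)
  have "\<Union>P \<noteq> {}" using P by auto
  then have N: "N > 0" using finU by (simp add: N_def card_gt_0_iff)
  have NP: "N = (\<Sum>B\<in>P. real (card B))"
    unfolding N_def by (subst card_Union_disjoint) (use P fin in \<open>auto simp: disjoint_def pairwise_def disjnt_def\<close>)
  have "T\<^sup>2 * N = (\<Sum>B\<in>P. T\<^sup>2 * card B)" by (simp add: NP sum_distrib_left)
  also have "\<dots> \<le> (\<Sum>B\<in>P. card B powr (1 - 2 * a) * (F B)\<^sup>2)"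
  proof (rule sum_mono)
    fix B assume B: "B \<in> P"
    have "(T * card B powr a)\<^sup>2 \<le> (F B)\<^sup>2" using heavy[OF B] T by (intro power_mono) auto
    moreover have "card B powr (1 - 2 * a) * (T * card B powr a)\<^sup>2 = T\<^sup>2 * card B"
    proof -
      have "(card B powr a)\<^sup>2 = card B powr (2 * a)" by (simp add: power2_eq_square powr_add[symmetric])
      then have "card B powr (1 - 2 * a) * (card B powr a)\<^sup>2 = card B"
        using pos[OF B] by (simp add: powr_add[symmetric])
      then show ?thesis by (simp only: power_mult_distrib mult.left_commute)
    qed
    ultimately show "T\<^sup>2 * card B \<le> card B powr (1 - 2 * a) * (F B)\<^sup>2"
      by (metis mult_left_mono powr_ge_zero)
  qed
  also have "\<dots> \<le> D\<^sup>2 * N powr (1 - 2 * a) * (F (\<Union>P))\<^sup>2" using quad by (simp add: N_def)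
  finally have "N powr (2 * a - 1) * (T\<^sup>2 * N) \<le> N powr (2 * a - 1) * (D\<^sup>2 * N powr (1 - 2 * a) * (F (\<Union>P))\<^sup>2)"
    by (intro mult_left_mono) auto
  moreover have "N powr (2 * a - 1) * N = (N powr a)\<^sup>2"
  proof -
    have "(N powr a)\<^sup>2 = N powr (2 * a)" by (simp add: power2_eq_square powr_add[symmetric])
    then show ?thesis using N by (simp add: powr_diff)
  qed
  moreover have "N powr (2 * a - 1) * N powr (1 - 2 * a) = 1" using N by (simp add: powr_add[symmetric])
  moreover have "N powr (2 * a - 1) * (D\<^sup>2 * N powr (1 - 2 * a) * (F (\<Union>P))\<^sup>2)
      = (N powr (2 * a - 1) * N powr (1 - 2 * a)) * (D * F (\<Union>P))\<^sup>2"
    by (simp only: power_mult_distrib mult_ac)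
  moreover have "N powr (2 * a - 1) * (T\<^sup>2 * N) = T\<^sup>2 * (N powr (2 * a - 1) * N)"
    by (simp only: mult_ac)
  ultimately have "(T * N powr a)\<^sup>2 \<le> (D * F (\<Union>P))\<^sup>2"
    by (simp only: power_mult_distrib mult_1)
  then have "T * N powr a \<le> D * F (\<Union>P)"
    by (rule power2_le_imp_le) (use D F in simp)
  then show ?thesis by (simp only: N_def)
qed

lemma flat_part_ravg:
  fixes x :: "nat \<Rightarrow> 'a::real_normed_vector"
  assumes cot: "weighted_cotype TYPE('a) a D" and I: "finite I" "S \<subseteq> I" and "0 \<le> T" "0 \<le> D" "0 \<le> a"
    and large: "D * ravg I x S < T * (card S / 2) powr a"
  obtains J where "J \<subseteq> S" "card S \<le> 2 * card J" "\<And>B. B \<subseteq> J \<Longrightarrow> B \<noteq> {} \<Longrightarrow> ravg I x B < T * card B powr a"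
proof (rule exhaustion[where F="ravg I x" and D=D])
  show fin: "finite S" using finite_subset[OF I(2,1)] .
  show "ravg I x U \<le> ravg I x S" if "U \<subseteq> S" for U using I that by (intro ravg_mono)
  show "T * card (\<Union>P) powr a \<le> D * ravg I x (\<Union>P)"
    if P: "P \<subseteq> Pow S" "P \<noteq> {}" "disjoint P" "{} \<notin> P" "\<And>B. B \<in> P \<Longrightarrow> T * card B powr a \<le> ravg I x B" for P
  proof (rule heavy_blocks)
    have U: "\<Union>P \<subseteq> S" using P by auto
    show "finite (\<Union>P)" using finite_subset[OF U fin] .
    show "(\<Sum>B\<in>P. card B powr (1 - 2 * a) * (ravg I x B)\<^sup>2)
      \<le> D\<^sup>2 * card (\<Union>P) powr (1 - 2 * a) * (ravg I x (\<Union>P))\<^sup>2"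
      using P U I by (intro ravg_blocks[OF cot]) auto
  qed (use P assms ravg_nonneg in simp_all)
qed (use assms that in auto)

lemma flat_part_max_signed:
  fixes x :: "nat \<Rightarrow> 'a::real_normed_vector"
  assumes cot: "weighted_cotype TYPE('a) a D" and fin: "finite S" and "0 \<le> T" "0 \<le> D" "0 \<le> a"
    and large: "D * max_signed x S < T * (card S / 2) powr a"
  obtains J where "J \<subseteq> S" "card S \<le> 2 * card J" "\<And>B. B \<subseteq> J \<Longrightarrow> B \<noteq> {} \<Longrightarrow> max_signed x B < T * card B powr a"
proof (rule exhaustion[where F="max_signed x" and D=D])
  show "max_signed x U \<le> max_signed x S" if "U \<subseteq> S" for U using fin that by (intro max_signed_mono)
  show "T * card (\<Union>P) powr a \<le> D * max_signed x (\<Union>P)"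
    if P: "P \<subseteq> Pow S" "P \<noteq> {}" "disjoint P" "{} \<notin> P" "\<And>B. B \<in> P \<Longrightarrow> T * card B powr a \<le> max_signed x B" for P
  proof (rule heavy_blocks)
    have U: "\<Union>P \<subseteq> S" using P by auto
    show finU: "finite (\<Union>P)" using finite_subset[OF U fin] .
    show "(\<Sum>B\<in>P. card B powr (1 - 2 * a) * (max_signed x B)\<^sup>2)
      \<le> D\<^sup>2 * card (\<Union>P) powr (1 - 2 * a) * (max_signed x (\<Union>P))\<^sup>2"
      using P finU by (intro max_signed_blocks[OF cot]) auto
    show "0 \<le> max_signed x (\<Union>P)" using finU by (rule max_signed_nonneg)
  qed (use P assms in auto)
qed (use assms that in auto)

section \<open>Systems with upper estimates\<close>

text \<open>A substitute for decreasing rearrangement: removing a smallest element again and again shows that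
  the \<open>j\<close>-th largest value is at most \<open>L * j powr (- c)\<close>.\<close>

lemma sum_powr_small_minima:
  fixes v :: "nat \<Rightarrow> real"
  assumes "finite S" "0 \<le> p" "0 \<le> L" "\<And>i. i \<in> S \<Longrightarrow> 0 \<le> v i"
    and "\<And>U. U \<subseteq> S \<Longrightarrow> U \<noteq> {} \<Longrightarrow> \<exists>i\<in>U. v i \<le> L * card U powr (- c)"
  shows "(\<Sum>i\<in>S. v i powr p) \<le> L powr p * (\<Sum>j=1..card S. real j powr (- (c * p)))"
  using assms
proof (induction "card S" arbitrary: S)
  case 0
  then show ?case by simp
next
  case (Suc k)
  then have "S \<noteq> {}" by auto
  then obtain i where i: "i \<in> S" "v i \<le> L * card S powr (- c)" using Suc.prems(5)[of S] by auto
  have S: "S = insert i (S - {i})" "card (S - {i}) = k" using i Suc.hyps Suc.prems by auto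
  have "(\<Sum>i\<in>S - {i}. v i powr p) \<le> L powr p * (\<Sum>j=1..card (S - {i}). real j powr (- (c * p)))"
  proof (rule Suc.hyps(1))
    show "\<exists>i\<in>U. v i \<le> L * card U powr (- c)" if "U \<subseteq> S - {i}" "U \<noteq> {}" for U
      using that by (intro Suc.prems(5)) auto
  qed (use S Suc.prems in auto)
  moreover have "v i powr p \<le> L powr p * real (Suc k) powr (- (c * p))"
  proof -
    have "v i powr p \<le> (L * card S powr (- c)) powr p"
      using Suc.prems i by (intro powr_mono2) auto
    also have "\<dots> = L powr p * real (Suc k) powr (- (c * p))"
      using Suc.prems by (simp add: powr_mult powr_powr flip: Suc.hyps(2))
    finally show ?thesis .
  qed
  moreover have "(\<Sum>i\<in>S. v i powr p) = v i powr p + (\<Sum>i\<in>S - {i}. v i powr p)"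
    using Suc.prems(1) i by (simp add: sum.remove)
  ultimately show ?case
    unfolding Suc.hyps(2)[symmetric] S(2) by (simp add: distrib_left)
qed

text \<open>If all large systems of vectors of norm at least 1 had averages above \<open>card S powr \<beta>\<close>, then
  rescaling would bound the smallest norm in every subset \<open>U\<close> of a given system by a multiple of
  \<open>card U powr (- \<beta>)\<close>. As \<open>\<beta> * p > 1\<close>, the sum of the \<open>p\<close>-th powers of the norms would
  then be controlled by a convergent series, that is, the space would have cotype \<open>p\<close>.\<close>

lemma large_system_without_cotype:
  assumes no: "\<not> has_cotype TYPE('a::real_normed_vector) (ereal p)" and p: "0 < p" and \<beta>: "1 / p < \<beta>"
  obtains n S and x :: "nat \<Rightarrow> 'a::real_normed_vector" where "S \<subseteq> {..<n}" "M \<le> card S" "S \<noteq> {}"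
    "\<And>i. i \<in> S \<Longrightarrow> 1 \<le> norm (x i)" "ravg {..<n} x S \<le> card S powr \<beta>"
proof -
  define M' where "M' = max 1 M"
  have "\<exists>n S (x :: nat \<Rightarrow> 'a). S \<subseteq> {..<n} \<and> M' \<le> card S \<and> (\<forall>i\<in>S. 1 \<le> norm (x i)) \<and> ravg {..<n} x S \<le> card S powr \<beta>"
  proof (rule ccontr)
    assume none: "\<not> ?thesis"
    have b: "0 < \<beta>" "1 < \<beta> * p" using p \<beta> by (auto simp: field_simps intro: less_trans[of 0 "1/p"])
    have sm: "summable (\<lambda>j. real j powr (- (\<beta> * p)))" using b by (simp add: summable_real_powr_iff)
    define G where "G = (\<Sum>j. real j powr (- (\<beta> * p)))"
    define C where "C = M' powr \<beta> * G powr (1 / p)"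
    have "(\<Sum>i<n. norm (y i) powr p) powr (1 / p) \<le> C * rademacher_avg n y" for n and y :: "nat \<Rightarrow> 'a"
    proof -
      define R where "R = rademacher_avg n y"
      have R: "0 \<le> R" by (simp add: R_def rademacher_avg_eq_ravg ravg_nonneg)
      have le: "norm (y i) \<le> R" if "i < n" for i
        unfolding R_def rademacher_avg_eq_ravg using that by (intro norm_le_ravg) auto
      have "\<exists>i\<in>U. norm (y i) \<le> (R * M' powr \<beta>) * card U powr (- \<beta>)" if U: "U \<subseteq> {..<n}" "U \<noteq> {}" for U
      proof (rule ccontr)
        assume "\<not> ?thesis"
        then have big: "(R * M' powr \<beta>) * card U powr (- \<beta>) < norm (y i)" if "i \<in> U" for i
          using that by (auto simp: not_le)
        obtain i where i: "i \<in> U" using U by auto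
        have cU: "0 < card U" using U finite_subset[OF U(1)] by (auto simp: card_gt_0_iff)
        have Rpos: "0 < R" using le[of i] big[OF i] U i R
          by (smt (verit) lessThan_iff mult_nonneg_nonneg powr_ge_zero subsetD)
        define c where "c = R * card U powr (- \<beta>)"
        have c: "0 < c" using Rpos cU by (simp add: c_def)
        have "R * (M' powr \<beta> * card U powr (- \<beta>)) < R * 1"
          using big[OF i] le[of i] U i by (auto simp: mult.assoc)
        then have "M' powr \<beta> * card U powr (- \<beta>) < 1" using Rpos by (simp only: mult_less_cancel_left_pos)
        then have "M' powr \<beta> < card U powr \<beta>" using cU by (simp add: powr_minus field_simps)
        then have M: "M' \<le> card U" using b powr_mono2[of \<beta> "card U" M'] by (force simp: not_le)
        have "1 \<le> norm ((1 / c) *\<^sub>R y i)" if "i \<in> U" for i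
        proof -
          have "c * 1 \<le> c * M' powr \<beta>" using c b by (intro mult_left_mono) (auto simp: M'_def ge_one_powr_ge_zero)
          then have "c < norm (y i)" using big[OF that] by (simp add: c_def mult_ac)
          then show ?thesis using c by (simp add: field_simps)
        qed
        moreover have "ravg {..<n} (\<lambda>i. (1 / c) *\<^sub>R y i) U \<le> card U powr \<beta>"
        proof -
          have "ravg {..<n} y U \<le> R" unfolding R_def rademacher_avg_eq_ravg using U by (intro ravg_mono) auto
          then have "ravg {..<n} (\<lambda>i. (1 / c) *\<^sub>R y i) U \<le> R / c" using c by (simp add: ravg_scale divide_right_mono)
          also have "\<dots> = card U powr \<beta>" using Rpos cU by (simp add: c_def powr_minus field_simps)
          finally show ?thesis .
        qed
        ultimately have "\<exists>n S (x :: nat \<Rightarrow> 'a). S \<subseteq> {..<n} \<and> M' \<le> card S \<and> (\<forall>i\<in>S. 1 \<le> norm (x i)) \<and> ravg {..<n} x S \<le> card S powr \<beta>"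
          using M U by (intro exI[of _ n] exI[of _ U] exI[of _ "\<lambda>i. (1 / c) *\<^sub>R y i"]) simp
        with none show False by contradiction
      qed
      then have "(\<Sum>i<n. norm (y i) powr p) \<le> (R * M' powr \<beta>) powr p * (\<Sum>j=1..card {..<n}. real j powr (- (\<beta> * p)))"
        using R p by (intro sum_powr_small_minima) auto
      also have "\<dots> \<le> (R * M' powr \<beta>) powr p * G"
        unfolding G_def by (intro mult_left_mono sum_le_suminf sm) auto
      finally have "(\<Sum>i<n. norm (y i) powr p) powr (1 / p) \<le> ((R * M' powr \<beta>) powr p * G) powr (1 / p)"
        using p by (intro powr_mono2) (auto intro: sum_nonneg)
      also have "\<dots> = C * R"
      proof -
        have "0 \<le> G" unfolding G_def by (intro suminf_nonneg sm) auto
        then show ?thesis using p R by (simp add: C_def powr_mult powr_powr)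
      qed
      finally show ?thesis by (simp add: R_def)
    qed
    then have "has_cotype TYPE('a) (ereal p)" by (auto simp: has_cotype_def)
    with no show False by simp
  qed
  then obtain n S and x :: "nat \<Rightarrow> 'a" where "S \<subseteq> {..<n}" "M' \<le> card S"
    "\<forall>i\<in>S. 1 \<le> norm (x i)" "ravg {..<n} x S \<le> card S powr \<beta>" by blast
  then show thesis by (intro that[of S n x]) (auto simp: M'_def)
qed

text \<open>Each step halves the maximum and adds one average. As the bounds for the averages decrease at most by the factor
  \<open>2 powr b \<le> 3 / 2\<close> per step, the accumulated averages form a geometric sum dominated by the last
  one; the constant 10 satisfies \<open>(10 / 2 + 1) * (3 / 2) \<le> 10\<close>.\<close>

lemma iterated_halving:
  assumes I: "finite I" "S \<subseteq> I" and card: "card S = 2 ^ k" and T: "0 \<le> T" and b: "0 \<le> b" "b \<le> 1 / 2"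
    and flat: "\<And>B. B \<subseteq> S \<Longrightarrow> B \<noteq> {} \<Longrightarrow> ravg I x B \<le> T * card B powr b" and "t \<le> k"
  shows "\<exists>J\<subseteq>S. card J = 2 ^ (k - t) \<and> max_signed x J \<le> max_signed x S / 2 ^ t + 10 * T * (2 ^ (k - t)) powr b"
  using \<open>t \<le> k\<close>
proof (induction t)
  case 0
  show ?case using card T by (intro exI[of _ S]) simp
next
  case (Suc t)
  then obtain J where J: "J \<subseteq> S" "card J = 2 ^ (k - t)"
    "max_signed x J \<le> max_signed x S / 2 ^ t + 10 * T * (2 ^ (k - t)) powr b" by auto
  have finJ: "finite J" using finite_subset[OF subset_trans[OF J(1) I(2)] I(1)] .
  obtain J' where J': "J' \<subseteq> J" "card J \<le> 2 * card J'" "max_signed x J' \<le> max_signed x J / 2 + ravg I x J"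
    using max_signed_halving[of I J x] I J by blast
  have kt: "k - t = Suc (k - Suc t)" using Suc.prems by simp
  define u where "u = (2 ^ (k - Suc t) :: real) powr b"
  have u: "(2 ^ (k - t)) powr b \<le> (3 / 2) * u"
  proof -
    have "(2::real) powr b \<le> 2 powr (1 / 2)" using b by (intro powr_mono) auto
    also have "\<dots> \<le> 3 / 2" unfolding powr_half_sqrt[OF zero_le_numeral]
      by (rule real_le_lsqrt) (auto simp: power2_eq_square)
    finally show ?thesis unfolding kt u_def by (simp add: powr_mult mult_right_mono)
  qed
  have "2 ^ (k - Suc t) \<le> card J'" using J' J kt by simp
  then obtain J'' where J'': "J'' \<subseteq> J'" "card J'' = 2 ^ (k - Suc t)"
    by (metis obtain_subset_with_card_n)
  have "max_signed x J'' \<le> max_signed x J'"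
    using J''(1) finite_subset[OF J'(1) finJ] by (intro max_signed_mono)
  also have "\<dots> \<le> (max_signed x S / 2 ^ t + 10 * T * (2 ^ (k - t)) powr b) / 2 + T * card J powr b"
  proof -
    have "J \<noteq> {}" using J(2) by auto
    then have "ravg I x J \<le> T * card J powr b" using flat J(1) by simp
    with J'(3) J(3) show ?thesis by argo
  qed
  also have "\<dots> = max_signed x S / 2 ^ Suc t + 6 * (T * (2 ^ (k - t)) powr b)" by (simp add: J field_simps)
  also have "\<dots> \<le> max_signed x S / 2 ^ Suc t + 6 * (T * ((3 / 2) * u))"
    using u T by (intro add_left_mono mult_left_mono) auto
  also have "\<dots> \<le> max_signed x S / 2 ^ Suc t + 10 * T * (2 ^ (k - Suc t)) powr b"
    using T by (simp add: u_def)
  finally show ?case using J'' J' J by (intro exI[of _ J'']) auto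
qed

text \<open>Initially the maximum is at most \<open>sqrt (card S)\<close> times the average. The condition on
  \<open>l\<close> says that the halvings have made this initial term smaller than the average on the set of
  size \<open>2 ^ l\<close>. If \<open>b < 1 / 2\<close>, it admits \<open>l\<close> up to a fixed positive proportion of
  \<open>k\<close>.\<close>

lemma sparse_part:
  assumes I: "finite I" "S \<subseteq> I" and card: "card S = 2 ^ k" and T: "0 \<le> T" and b: "0 \<le> b" "b \<le> 1 / 2"
    and flat: "\<And>B. B \<subseteq> S \<Longrightarrow> B \<noteq> {} \<Longrightarrow> ravg I x B \<le> T * card B powr b"
    and l: "l \<le> k" "l * (1 - b) \<le> k * (1 / 2 - b)"
  obtains J where "J \<subseteq> S" "card J = 2 ^ l" "max_signed x J \<le> 11 * T * (2 ^ l) powr b"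
proof -
  obtain J where J: "J \<subseteq> S" "card J = 2 ^ (k - (k - l))"
    "max_signed x J \<le> max_signed x S / 2 ^ (k - l) + 10 * T * (2 ^ (k - (k - l))) powr b"
    using iterated_halving[OF I card T b flat, of "k - l"] by auto
  have pw: "((2::real) ^ i) powr c = 2 powr (i * c)" for i :: nat and c :: real
    by (simp add: powr_powr flip: powr_realpow)
  have "S \<noteq> {}" using card by auto
  have "max_signed x S \<le> sqrt (card S) * ravg I x S" by (rule max_signed_le_ravg[OF I])
  also have "\<dots> \<le> sqrt (card S) * (T * card S powr b)"
    using flat[of S] \<open>S \<noteq> {}\<close> by (intro mult_left_mono) auto
  also have "\<dots> = T * 2 powr (k * (1 / 2 + b))"
  proof -
    have "sqrt (2 ^ k) = ((2::real) ^ k) powr (1 / 2)" by (rule powr_half_sqrt[symmetric]) simp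
    also have "\<dots> = 2 powr (k * (1 / 2))" by (rule pw)
    finally show ?thesis by (simp add: card pw distrib_left powr_add)
  qed
  finally have "max_signed x S / 2 ^ (k - l) \<le> T * 2 powr (k * (1 / 2 + b)) / 2 powr (real k - real l)"
    using l by (simp add: powr_realpow[symmetric] of_nat_diff divide_right_mono)
  also have "\<dots> = T * 2 powr (k * (1 / 2 + b) - (real k - real l))" by (simp add: powr_diff)
  also have "\<dots> \<le> T * 2 powr (l * b)"
    using l T by (intro mult_left_mono powr_mono) (auto simp: algebra_simps)
  finally have "max_signed x J \<le> 11 * T * (2 ^ l) powr b" using J l by (simp add: pw)
  with J l that show thesis by simp
qed

text \<open>The number \<open>b\<close> is the reciprocal of \<open>cotype_inf\<close>, with \<open>b = 0\<close> for the value
  \<open>\<infinity>\<close>. Cotype holds for exponents arbitrarily close to the infimum and fails for all smaller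
  ones.\<close>

lemma cotype_exponents:
  assumes cot: "2 < cotype_inf TYPE('a::real_normed_vector)"
  obtains b where "0 \<le> b" "b < 1 / 2"
    "\<And>\<tau>. 0 < \<tau> \<Longrightarrow> \<exists>a D. 0 \<le> a \<and> a \<le> b \<and> b \<le> a + \<tau> \<and> 0 < D \<and> weighted_cotype TYPE('a) a D"
    "\<And>\<beta>. b < \<beta> \<Longrightarrow> \<exists>p>0. 1 / p < \<beta> \<and> \<not> has_cotype TYPE('a) (ereal p)"
proof -
  have no: "\<not> has_cotype TYPE('a) (ereal p)" if "2 \<le> p" "ereal p < cotype_inf TYPE('a)" for p
  proof
    assume "has_cotype TYPE('a) (ereal p)"
    then have "cotype_inf TYPE('a) \<le> ereal p"
      unfolding cotype_inf_def using that(1) by (intro Inf_lower) (auto simp: numeral_eq_ereal)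
    with that(2) show False by simp
  qed
  show thesis
  proof (cases "cotype_inf TYPE('a)")
    case PInf
    show thesis
    proof (rule that[of 0])
      show "\<exists>a D. 0 \<le> a \<and> a \<le> 0 \<and> 0 \<le> a + \<tau> \<and> 0 < D \<and> weighted_cotype TYPE('a) a D" if "0 < \<tau>" for \<tau> :: real
        using that weighted_cotype_infinity by (intro exI[of _ 0] exI[of _ 1]) auto
      show "\<exists>p>0. 1 / p < \<beta> \<and> \<not> has_cotype TYPE('a) (ereal p)" if "0 < \<beta>" for \<beta>
      proof -
        define p where "p = max 2 (2 / \<beta>)"
        have "1 / \<beta> < p" using that by (simp add: p_def field_simps less_max_iff_disj)
        moreover have p: "2 \<le> p" by (simp add: p_def)
        ultimately have "1 / p < \<beta>" using that by (simp add: field_simps)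
        moreover have "\<not> has_cotype TYPE('a) (ereal p)" by (rule no[OF p]) (simp add: PInf)
        ultimately show ?thesis using p by (intro exI[of _ p]) auto
      qed
    qed auto
  next
    case (real q)
    then have q: "2 < q" using cot by (simp add: numeral_eq_ereal)
    show thesis
    proof (rule that[of "1 / q"])
      show "\<exists>a D. 0 \<le> a \<and> a \<le> 1 / q \<and> 1 / q \<le> a + \<tau> \<and> 0 < D \<and> weighted_cotype TYPE('a) a D" if \<tau>: "0 < \<tau>" for \<tau>
      proof -
        have "cotype_inf TYPE('a) < ereal (q + \<tau> * q\<^sup>2)" using real \<tau> q by simp
        then obtain p where p: "2 \<le> p" "has_cotype TYPE('a) p" "p < ereal (q + \<tau> * q\<^sup>2)"
          unfolding cotype_inf_def by (auto simp: Inf_less_iff)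
        then have "cotype_inf TYPE('a) \<le> p" unfolding cotype_inf_def by (intro Inf_lower) auto
        then obtain p' where p': "p = ereal p'" "q \<le> p'" using p real by (cases p) auto
        obtain D where D: "0 < D" "weighted_cotype TYPE('a) (1 / p') D"
          using weighted_cotype_of_cotype[of p'] p p' q by auto
        have "p' - q \<le> \<tau> * q * q" using p p' by (simp add: power2_eq_square)
        also have "\<dots> \<le> \<tau> * q * p'" using p' q \<tau> by (intro mult_left_mono) auto
        finally have "1 / q \<le> 1 / p' + \<tau>" using p' q by (simp add: field_simps)
        moreover have "1 / p' \<le> 1 / q" using p' q by (simp add: field_simps)
        ultimately show ?thesis using D p' q by (intro exI[of _ "1 / p'"] exI[of _ D]) auto
      qed
      show "\<exists>p>0. 1 / p < \<beta> \<and> \<not> has_cotype TYPE('a) (ereal p)" if "1 / q < \<beta>" for \<beta>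
      proof -
        have \<beta>: "0 < \<beta>" using that q by (smt (verit) divide_pos_pos)
        have "1 / \<beta> < q" using that \<beta> q by (simp add: field_simps)
        then obtain p where p: "max 2 (1 / \<beta>) < p" "p < q" using q dense[of "max 2 (1 / \<beta>)" q] by auto
        then have "1 / p < \<beta>" using \<beta> by (simp add: field_simps)
        moreover have "\<not> has_cotype TYPE('a) (ereal p)" by (rule no) (use p real in auto)
        ultimately show ?thesis using p by (intro exI[of _ p]) auto
      qed
    qed (use q in auto)
  qed (use cot in auto)
qed

text \<open>A weak form of the Maurey--Pisier theorem: up to arbitrarily small powers of the cardinality, the
  space contains systems that satisfy the same upper estimates for signed sums as the unit vectors of
  \<open>\<ell>\<^sub>q\<close>, where \<open>1 / q = b\<close>.\<close>

lemma upper_estimates: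
  assumes cot: "2 < cotype_inf TYPE('a::real_normed_vector)"
  obtains b where "0 \<le> b" "b < 1 / 2"
    "\<And>\<delta>. 0 < \<delta> \<Longrightarrow> \<exists>C>0. \<forall>M::nat. \<exists>J (x :: nat \<Rightarrow> 'a). finite J \<and> M \<le> card J \<and> (\<forall>i\<in>J. 1 \<le> norm (x i)) \<and>
       (\<forall>B\<subseteq>J. max_signed x B \<le> C * card J powr \<delta> * card B powr b)"
proof -
  obtain b where b: "0 \<le> b" "b < 1 / 2"
    and ex_cot: "\<And>\<tau>. 0 < \<tau> \<Longrightarrow> \<exists>a D. 0 \<le> a \<and> a \<le> b \<and> b \<le> a + \<tau> \<and> 0 < D \<and> weighted_cotype TYPE('a) a D"
    and ex_no: "\<And>\<beta>. b < \<beta> \<Longrightarrow> \<exists>p>0. 1 / p < \<beta> \<and> \<not> has_cotype TYPE('a) (ereal p)"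
    using cotype_exponents[OF cot] by metis
  have pw: "((2::real) ^ i) powr c = 2 powr (i * c)" for i :: nat and c :: real
    by (simp add: powr_powr flip: powr_realpow)
  have "\<exists>C>0. \<forall>M::nat. \<exists>J (x :: nat \<Rightarrow> 'a). finite J \<and> M \<le> card J \<and> (\<forall>i\<in>J. 1 \<le> norm (x i)) \<and>
       (\<forall>B\<subseteq>J. max_signed x B \<le> C * card J powr \<delta> * card B powr b)" if \<delta>: "0 < \<delta>" for \<delta>
  proof -
    define \<gamma> where "\<gamma> = 1 / 2 - b"
    define \<tau> where "\<tau> = \<delta> * \<gamma> / 4"
    define \<beta> where "\<beta> = b + \<tau>"
    have \<gamma>: "0 < \<gamma>" "\<gamma> \<le> 1 / 2" using b by (auto simp: \<gamma>_def)
    have \<tau>: "0 < \<tau>" "\<tau> \<le> \<delta> / 8" using \<delta> \<gamma> by (auto simp: \<tau>_def)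
    obtain a D where a: "0 \<le> a" "a \<le> b" "b \<le> a + \<tau>" and D: "0 < D" and wc: "weighted_cotype TYPE('a) a D"
      using ex_cot[OF \<tau>(1)] by blast
    obtain p where p: "0 < p" "1 / p < \<beta>" "\<not> has_cotype TYPE('a) (ereal p)"
      using ex_no[of \<beta>] \<tau> by (auto simp: \<beta>_def)
    \<comment> \<open>The factor 2 in the thresholds \<open>T\<close> and \<open>T'\<close> below makes up for the loss of half of
      the elements in an exhaustion.\<close>
    have half: "1 < 2 * (1 / 2 :: real) powr a"
    proof -
      have "(1 / 2 :: real) powr 1 < (1 / 2) powr a" using a b by (intro powr_less_mono') auto
      then show ?thesis by simp
    qed
    define C1 where "C1 = 22 * D * 2 powr \<delta>"
    define C where "C = 2 * D * C1 * 2 powr \<delta>"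
    have C1: "0 < C1" using D by (simp add: C1_def)
    have C: "0 < C" using D C1 by (simp add: C_def)
    have "\<exists>J (x :: nat \<Rightarrow> 'a). finite J \<and> M \<le> card J \<and> (\<forall>i\<in>J. 1 \<le> norm (x i)) \<and>
       (\<forall>B\<subseteq>J. max_signed x B \<le> C * card J powr \<delta> * card B powr b)" for M :: nat
    proof -
      \<comment> \<open>Each exhaustion and the sparsification shrink the system; \<open>k0\<close> is so large that \<open>M\<close>
        elements remain at the end.\<close>
      obtain k0 :: nat where k0: "(real M + 1) / \<gamma> \<le> k0" using real_arch_simple by blast
      obtain n S and x :: "nat \<Rightarrow> 'a" where S: "S \<subseteq> {..<n}" "2 ^ (k0 + 1) \<le> card S" "S \<noteq> {}"
        "\<And>i. i \<in> S \<Longrightarrow> 1 \<le> norm (x i)" "ravg {..<n} x S \<le> card S powr \<beta>"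
        using large_system_without_cotype[OF p(3,1,2), of "2 ^ (k0 + 1)"] by metis
      define N where "N = real (card S)"
      have N: "1 \<le> N" using S(2) one_le_power[of "2::nat" "k0 + 1"] unfolding N_def by linarith
      \<comment> \<open>First exhaustion: all averages over subsets become small.\<close>
      define T where "T = 2 * D * N powr (2 * \<tau>)"
      have T: "0 < T" using D N by (simp add: T_def)
      have "D * ravg {..<n} x S \<le> D * N powr (2 * \<tau> + a)"
        using S(5) D N a powr_mono[of \<beta> "2 * \<tau> + a" N]
        by (intro mult_left_mono) (auto simp: N_def \<beta>_def)
      also have "\<dots> < (D * N powr (2 * \<tau> + a)) * (2 * (1 / 2) powr a)"
        using mult_strict_left_mono[OF half, of "D * N powr (2 * \<tau> + a)"] D N by simp
      also have "\<dots> = T * (N / 2) powr a" using N by (simp add: T_def powr_add powr_divide)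
      finally have large: "D * ravg {..<n} x S < T * (card S / 2) powr a" by (simp add: N_def)
      obtain S1 where S1: "S1 \<subseteq> S" "card S \<le> 2 * card S1"
        "\<And>B. B \<subseteq> S1 \<Longrightarrow> B \<noteq> {} \<Longrightarrow> ravg {..<n} x B < T * card B powr a"
        by (rule flat_part_ravg[OF wc finite_lessThan S(1) less_imp_le[OF T] less_imp_le[OF D] a(1) large]) blast
      have finS1: "finite S1" using finite_subset[OF S1(1) finite_subset[OF S(1) finite_lessThan]] .
      have "1 \<le> card S1" using S1(2) S(2) by (cases "card S1") auto
      then obtain k where k: "2 ^ k \<le> card S1" "card S1 < 2 ^ (k + 1)"
        using ex_power_ivl1[of 2 "card S1"] by auto
      obtain S0 where S0: "S0 \<subseteq> S1" "card S0 = 2 ^ k" using obtain_subset_with_card_n[OF k(1)] by metis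
      have "(2::nat) ^ k0 < 2 ^ (k + 1)" using S(2) S1(2) k(2) by simp
      then have "k0 \<le> k" using power_less_imp_less_exp[of "2::nat" k0 "k + 1"] by simp
      have flat: "ravg {..<n} x B \<le> T * card B powr b" if "B \<subseteq> S0" "B \<noteq> {}" for B
      proof -
        have "finite B" using that(1) S0(1) finS1 by (meson finite_subset)
        then have "1 \<le> card B" using that by (simp add: Suc_leI card_gt_0_iff)
        then have "T * card B powr a \<le> T * card B powr b"
          using T a by (intro mult_left_mono powr_mono) auto
        then show ?thesis using S1(3)[of B] that S0 by fastforce
      qed
      \<comment> \<open>Sparsification: averages are replaced by maxima over the signs.\<close>
      define l where "l = nat \<lfloor>\<gamma> * k\<rfloor>"
      have int_l: "int l = \<lfloor>\<gamma> * k\<rfloor>" using \<gamma> by (simp add: l_def)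
      have l: "real l \<le> \<gamma> * k" "\<gamma> * k < real l + 1" using int_l by linarith+
      have "\<gamma> * k \<le> 1 * real k" using \<gamma> by (intro mult_right_mono) auto
      then have lk: "l \<le> k" using l by linarith
      have "l * (1 - b) \<le> real l * 1" using b by (intro mult_left_mono) auto
      then have lb: "l * (1 - b) \<le> k * (1 / 2 - b)" using l by (simp add: \<gamma>_def mult.commute)
      have Ml: "M + 1 \<le> l"
      proof -
        have "real M + 1 \<le> \<gamma> * k0" using k0 \<gamma> by (simp add: field_simps)
        also have "\<dots> \<le> \<gamma> * k" using \<open>k0 \<le> k\<close> \<gamma> by simp
        finally show ?thesis using int_l by linarith
      qed
      have S0n: "S0 \<subseteq> {..<n}" using S0 S1 S by blast
      have bh: "b \<le> 1 / 2" using b by simp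
      obtain J where J: "J \<subseteq> S0" "card J = 2 ^ l" "max_signed x J \<le> 11 * T * (2 ^ l) powr b"
        by (rule sparse_part[OF finite_lessThan S0n S0(2) less_imp_le[OF T] b(1) bh flat lk lb]) blast
      have finJ: "finite J" using finite_subset[OF J(1) finite_subset[OF S0(1) finS1]] .
      define m where "m = real (card J)"
      have m: "1 \<le> m" "m = 2 ^ l" by (auto simp: m_def J)
      have "N powr (2 * \<tau>) \<le> 2 powr \<delta> * m powr (\<delta> / 2)"
      proof -
        have "N \<le> real (2 ^ (k + 2))" using S1(2) k(2) unfolding N_def by (intro of_nat_mono) simp
        then have "N powr (2 * \<tau>) \<le> (2 ^ (k + 2)) powr (2 * \<tau>)"
          using N \<tau> by (intro powr_mono2) auto
        also have "\<dots> = 2 powr (real (k + 2) * (2 * \<tau>))" by (rule pw)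
        also have "real (k + 2) * (2 * \<tau>) = \<delta> / 2 * (\<gamma> * k) + \<delta> * \<gamma>" by (simp add: \<tau>_def field_simps)
        also have "\<dots> \<le> \<delta> / 2 * (real l + 1) + \<delta> * (1 / 2)"
          using l \<delta> \<gamma> by (intro add_mono mult_left_mono) auto
        also have "\<dots> = \<delta> + l * (\<delta> / 2)" by (simp add: field_simps)
        finally show ?thesis by (simp add: m(2) pw powr_add)
      qed
      then have "T \<le> 2 * D * (2 powr \<delta> * m powr (\<delta> / 2))" using D by (simp add: T_def)
      then have "11 * T * (2 ^ l) powr b \<le> 11 * (2 * D * (2 powr \<delta> * m powr (\<delta> / 2))) * m powr b"
        unfolding m(2) by (intro mult_right_mono mult_left_mono) auto
      then have WJ: "max_signed x J \<le> C1 * m powr (\<delta> / 2 + b)"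
        using J(3) by (simp add: C1_def powr_add mult_ac)
      \<comment> \<open>Second exhaustion: the maxima over all subsets become small.\<close>
      define T' where "T' = 2 * D * C1 * m powr (\<delta> / 2 + \<tau>)"
      have T': "0 < T'" using D C1 m by (simp add: T'_def)
      have "D * max_signed x J \<le> D * (C1 * m powr (\<delta> / 2 + \<tau> + a))"
      proof -
        have "m powr (\<delta> / 2 + b) \<le> m powr (\<delta> / 2 + \<tau> + a)" using a m(1) by (intro powr_mono) auto
        then have "C1 * m powr (\<delta> / 2 + b) \<le> C1 * m powr (\<delta> / 2 + \<tau> + a)" using C1 by simp
        then show ?thesis using WJ D by (intro mult_left_mono) auto
      qed
      also have "\<dots> < D * (C1 * m powr (\<delta> / 2 + \<tau> + a)) * (2 * (1 / 2) powr a)"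
        using mult_strict_left_mono[OF half, of "D * (C1 * m powr (\<delta> / 2 + \<tau> + a))"] D C1 m by simp
      also have "\<dots> = T' * (m / 2) powr a" using m(1) by (simp add: T'_def powr_add powr_divide mult_ac)
      finally have large': "D * max_signed x J < T' * (card J / 2) powr a" by (simp add: m_def)
      obtain J' where J': "J' \<subseteq> J" "card J \<le> 2 * card J'"
        "\<And>B. B \<subseteq> J' \<Longrightarrow> B \<noteq> {} \<Longrightarrow> max_signed x B < T' * card B powr a"
        by (rule flat_part_max_signed[OF wc finJ less_imp_le[OF T'] less_imp_le[OF D] a(1) large']) blast
      have finJ': "finite J'" using finite_subset[OF J'(1) finJ] .
      have T'le: "T' \<le> C * card J' powr \<delta>"
      proof -
        have "m powr (\<delta> / 2 + \<tau>) \<le> m powr \<delta>" using m \<tau> \<delta> by (intro powr_mono) auto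
        also have "\<dots> \<le> (2 * real (card J')) powr \<delta>"
          using J'(2) \<delta> unfolding m_def by (intro powr_mono2) auto
        also have "\<dots> = 2 powr \<delta> * card J' powr \<delta>" by (simp add: powr_mult)
        finally show ?thesis using D C1 by (simp add: T'_def C_def mult_left_mono)
      qed
      have "M \<le> card J'"
      proof -
        have "M < 2 ^ M" by (rule less_exp)
        moreover have "(2::nat) * 2 ^ M \<le> 2 ^ l" using power_increasing[OF Ml, of "2::nat"] by simp
        ultimately show ?thesis using J'(2) J(2) by linarith
      qed
      moreover have "max_signed x B \<le> C * card J' powr \<delta> * card B powr b" if B: "B \<subseteq> J'" for B
      proof (cases "B = {}")
        case True
        then show ?thesis by (auto simp: max_signed_def signs_def)
      next
        case False
        then have cB: "1 \<le> card B" using finite_subset[OF B finJ'] by (simp add: Suc_leI card_gt_0_iff)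
        have "max_signed x B \<le> T' * card B powr a" using J'(3)[OF B False] by simp
        also have "\<dots> \<le> (C * card J' powr \<delta>) * card B powr b"
          using T'le T' a cB C by (intro mult_mono powr_mono) auto
        finally show ?thesis .
      qed
      moreover have "\<forall>i\<in>J'. 1 \<le> norm (x i)" using J'(1) J(1) S0(1) S1(1) S(4) by blast
      ultimately show ?thesis using finJ' by blast
    qed
    then show ?thesis using C by blast
  qed
  with that b show thesis by blast
qed

text \<open>Young's inequality gives \<open>k powr (1 - s) * (k + 1) powr s \<le> k + s\<close>, so that each term is bounded
  by a difference and the sum telescopes.\<close>

lemma sum_powr_le:
  assumes "0 \<le> s" "s < 1"
  shows "(\<Sum>j=1..m. real j powr (- s)) \<le> real m powr (1 - s) / (1 - s)"
proof (induction m)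
  case 0
  then show ?case by simp
next
  case (Suc k)
  have k1: "real (Suc k) powr (1 - s) = real (Suc k) * real (Suc k) powr (- s)"
    by (simp add: powr_diff powr_minus_divide)
  have "real k powr (1 - s) \<le> (real (Suc k) - (1 - s)) * real (Suc k) powr (- s)"
  proof (cases "k = 0")
    case False
    have "real k powr (1 - s) * real (Suc k) powr s \<le> (1 - s) * real k + s * real (Suc k)"
      using assms False by (intro Youngs_inequality_0) auto
    then have "real k powr (1 - s) \<le> ((1 - s) * real k + s * real (Suc k)) / real (Suc k) powr s"
      by (simp add: pos_le_divide_eq)
    also have "(1 - s) * real k + s * real (Suc k) = real (Suc k) - (1 - s)" by (simp add: algebra_simps)
    finally show ?thesis by (simp add: powr_minus_divide)
  qed (use assms in simp)
  also have "\<dots> = real (Suc k) powr (1 - s) - (1 - s) * real (Suc k) powr (- s)"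
    unfolding k1 by (simp only: left_diff_distrib)
  finally have "real k powr (1 - s) / (1 - s) \<le> (real (Suc k) powr (1 - s) - (1 - s) * real (Suc k) powr (- s)) / (1 - s)"
    using assms by (intro divide_right_mono) auto
  also have "\<dots> = real (Suc k) powr (1 - s) / (1 - s) - real (Suc k) powr (- s)"
    using assms by (simp add: diff_divide_distrib)
  finally show ?case using Suc.IH by simp
qed

lemma sum_powr_of_subset_sums:
  fixes v :: "nat \<Rightarrow> real"
  assumes fin: "finite J" and v: "\<And>i. i \<in> J \<Longrightarrow> 0 \<le> v i" and L: "0 \<le> L" and r: "0 < r" "r * (1 - b) < 1" "b \<le> 1"
    and sub: "\<And>B. B \<subseteq> J \<Longrightarrow> B \<noteq> {} \<Longrightarrow> (\<Sum>i\<in>B. v i) \<le> L * card B powr b"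
  shows "(\<Sum>i\<in>J. v i powr r) \<le> L powr r * (card J powr (1 - r * (1 - b)) / (1 - r * (1 - b)))"
proof -
  have "\<exists>i\<in>B. v i \<le> L * card B powr (- (1 - b))" if B: "B \<subseteq> J" "B \<noteq> {}" for B
  proof (rule ccontr)
    assume "\<not> ?thesis"
    then have less: "L * card B powr (- (1 - b)) < v i" if "i \<in> B" for i using that by auto
    have finB: "finite B" using finite_subset[OF B(1) fin] .
    then have cB: "0 < card B" using B by (simp add: card_gt_0_iff)
    have "(\<Sum>i\<in>B. L * card B powr (- (1 - b))) < (\<Sum>i\<in>B. v i)"
      using less finB B by (intro sum_strict_mono) auto
    moreover have "(\<Sum>i\<in>B. L * card B powr (- (1 - b))) = L * card B powr b"
    proof -
      have "real (card B) * card B powr (- (1 - b)) = card B powr b"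
        using cB by (simp add: powr_diff)
      then show ?thesis by (simp only: sum_constant mult.left_commute)
    qed
    ultimately show False using sub[OF B] by linarith
  qed
  then have "(\<Sum>i\<in>J. v i powr r) \<le> L powr r * (\<Sum>j=1..card J. real j powr (- ((1 - b) * r)))"
    using r L v fin by (intro sum_powr_small_minima) auto
  also have "\<dots> \<le> L powr r * (card J powr (1 - r * (1 - b)) / (1 - r * (1 - b)))"
    using sum_powr_le[of "(1 - b) * r" "card J"] r by (intro mult_left_mono) (auto simp: mult.commute)
  finally show ?thesis .
qed

section \<open>Bilinear forms with large diagonals\<close>

lemma dual_unit_ballD:
  assumes "\<phi> \<in> dual_unit_ball smul"
  shows dual_unit_ball_bounded_linear: "bounded_linear \<phi>"
    and dual_unit_ball_smul: "\<phi> (smul c x) = c * \<phi> x"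
    and dual_unit_ball_norm_le: "norm (\<phi> x) \<le> norm x"
proof -
  show bl: "bounded_linear \<phi>" and "\<phi> (smul c x) = c * \<phi> x"
    using assms by (auto simp: dual_unit_ball_def)
  have "norm (\<phi> x) \<le> onorm \<phi> * norm x" by (rule onorm[OF bl])
  also have "\<dots> \<le> 1 * norm x" using assms by (intro mult_right_mono) (auto simp: dual_unit_ball_def)
  finally show "norm (\<phi> x) \<le> norm x" by simp
qed

lemma bilinear_form_from_functionals:
  fixes smul :: "'k::real_normed_field \<Rightarrow> 'a::real_normed_vector \<Rightarrow> 'a" and c :: "nat \<Rightarrow> real"
  assumes \<phi>: "\<And>i. i \<in> J \<Longrightarrow> \<phi> i \<in> dual_unit_ball smul"
  defines "A \<equiv> \<lambda>u v. \<Sum>i\<in>J. c i *\<^sub>R (\<phi> i u * \<phi> i v)"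
  shows "A \<in> bilinear_forms smul" "norm (A u v) \<le> (\<Sum>i\<in>J. \<bar>c i\<bar>) * (norm u * norm v)"
proof -
  have lin: "\<phi> i (u + v) = \<phi> i u + \<phi> i v" "\<phi> i (t *\<^sub>R u) = t *\<^sub>R \<phi> i u" "\<phi> i (smul d u) = d * \<phi> i u"
    if "i \<in> J" for i u v t d
    using dual_unit_ball_bounded_linear[OF \<phi>[OF that]] dual_unit_ball_smul[OF \<phi>[OF that]]
    by (simp_all add: linear_add linear_scale bounded_linear.linear)
  show le: "norm (A u v) \<le> (\<Sum>i\<in>J. \<bar>c i\<bar>) * (norm u * norm v)" for u v
  proof -
    have "norm (A u v) \<le> (\<Sum>i\<in>J. norm (c i *\<^sub>R (\<phi> i u * \<phi> i v)))" unfolding A_def by (rule norm_sum)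
    also have "\<dots> \<le> (\<Sum>i\<in>J. \<bar>c i\<bar> * (norm u * norm v))"
      using dual_unit_ball_norm_le[OF \<phi>] by (intro sum_mono) (auto simp: norm_mult intro!: mult_left_mono mult_mono)
    finally show ?thesis by (simp add: sum_distrib_right)
  qed
  have "bounded_bilinear A"
  proof
    show "\<exists>K. \<forall>a b. norm (A a b) \<le> norm a * norm b * K"
      using le by (intro exI[of _ "\<Sum>i\<in>J. \<bar>c i\<bar>"]) (simp add: mult.commute)
  qed (auto simp: A_def lin distrib_left distrib_right scaleR_add_right sum.distrib scaleR_sum_right mult.left_commute
         intro!: sum.cong)
  moreover have "A (smul d u) v = d * A u v" "A u (smul d v) = d * A u v" for d u v
    by (auto simp: A_def lin sum_distrib_left mult_ac intro!: sum.cong)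
  ultimately show "A \<in> bilinear_forms smul" by (simp add: bilinear_forms_def)
qed

text \<open>The form is \<open>1 / m\<close> times the sum of \<open>\<epsilon> i\<close> times \<open>\<phi> i \<otimes> \<phi> i\<close>, where \<open>m = card J\<close>.
  The off-diagonal values \<open>\<phi> j (x i)\<close> are unknown, but flipping the sign at \<open>i\<close> changes the
  value at \<open>(x i, x i)\<close> by at least \<open>2 / m\<close>, so it has modulus at least \<open>1 / m\<close> for one of
  the two signs. Averaging over all signs yields a choice that serves at least half of the indices in
  the mean.\<close>

lemma bilinear_form_large_on_diagonal:
  fixes smul :: "'k::real_normed_field \<Rightarrow> 'a::real_normed_vector \<Rightarrow> 'a"
    and J :: "nat set"
  assumes p: "0 < p" and fin: "finite J" and \<phi>: "\<And>i. i \<in> J \<Longrightarrow> \<phi> i \<in> dual_unit_ball smul"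
    and one: "\<And>i. i \<in> J \<Longrightarrow> 1 \<le> norm (\<phi> i (x i))"
  obtains A where "A \<in> bilinear_forms smul" "\<And>u v. norm (A u v) \<le> norm u * norm v"
    "card J powr (1 - p) / 2 \<le> (\<Sum>i\<in>J. norm (A (x i) (x i)) powr p)"
proof -
  define m where "m = real (card J)"
  define A where "A \<epsilon> u v = (\<Sum>i\<in>J. (\<epsilon> i / m) *\<^sub>R (\<phi> i u * \<phi> i v))" for \<epsilon> :: "nat \<Rightarrow> real" and u v
  define g where "g \<epsilon> i = norm (A \<epsilon> (x i) (x i)) powr p" for \<epsilon> i
  have each: "2 ^ card J * m powr (- p) \<le> 2 * (\<Sum>\<epsilon>\<in>signs J. g \<epsilon> i)" if i: "i \<in> J" for i
  proof -
    have m: "0 < m" using i fin by (auto simp: m_def card_gt_0_iff)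
    define s :: "nat \<Rightarrow> real" where "s j = (if j = i then -1 else 1)" for j
    have pair: "m powr (- p) \<le> g \<epsilon> i + g (flip J s \<epsilon>) i" if \<epsilon>: "\<epsilon> \<in> signs J" for \<epsilon>
    proof -
      have split: "A \<eta> u v = (\<eta> i / m) *\<^sub>R (\<phi> i u * \<phi> i v) + (\<Sum>j\<in>J - {i}. (\<eta> j / m) *\<^sub>R (\<phi> j u * \<phi> j v))" for \<eta> u v
        unfolding A_def using fin i by (rule sum.remove)
      have "A (flip J s \<epsilon>) u v = - (\<epsilon> i / m) *\<^sub>R (\<phi> i u * \<phi> i v) + (\<Sum>j\<in>J - {i}. (\<epsilon> j / m) *\<^sub>R (\<phi> j u * \<phi> j v))" for u v
      proof -
        have "(\<Sum>j\<in>J - {i}. (flip J s \<epsilon> j / m) *\<^sub>R (\<phi> j u * \<phi> j v)) = (\<Sum>j\<in>J - {i}. (\<epsilon> j / m) *\<^sub>R (\<phi> j u * \<phi> j v))"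
          by (intro sum.cong) (auto simp: flip_def s_def)
        moreover have "flip J s \<epsilon> i = - \<epsilon> i" using i by (simp add: flip_def s_def)
        ultimately show ?thesis unfolding split by simp
      qed
      then have "A \<epsilon> (x i) (x i) - A (flip J s \<epsilon>) (x i) (x i) = (2 * \<epsilon> i / m) *\<^sub>R (\<phi> i (x i) * \<phi> i (x i))"
        unfolding split[of \<epsilon>] by (simp add: scaleR_add_left[symmetric])
      then have "norm (A \<epsilon> (x i) (x i) - A (flip J s \<epsilon>) (x i) (x i)) = 2 / m * (norm (\<phi> i (x i)) * norm (\<phi> i (x i)))"
        using signsD[OF \<epsilon> i] m by (auto simp: norm_mult)
      moreover have "1 * 1 \<le> norm (\<phi> i (x i)) * norm (\<phi> i (x i))" using one[OF i] by (intro mult_mono) auto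
      ultimately have "2 / m \<le> norm (A \<epsilon> (x i) (x i) - A (flip J s \<epsilon>) (x i) (x i))"
        using m mult_left_mono[of 1 "norm (\<phi> i (x i)) * norm (\<phi> i (x i))" "2 / m"] by simp
      also have "\<dots> \<le> norm (A \<epsilon> (x i) (x i)) + norm (A (flip J s \<epsilon>) (x i) (x i))" by (rule norm_triangle_ineq4)
      also have "2 / m = 1 / m + 1 / m" by simp
      finally have "1 / m \<le> norm (A \<epsilon> (x i) (x i)) \<or> 1 / m \<le> norm (A (flip J s \<epsilon>) (x i) (x i))" by linarith
      then have "(1 / m) powr p \<le> g \<epsilon> i \<or> (1 / m) powr p \<le> g (flip J s \<epsilon>) i"
        unfolding g_def using p m by (auto intro!: powr_mono2)
      moreover have "0 \<le> g \<epsilon> i" "0 \<le> g (flip J s \<epsilon>) i" by (simp_all add: g_def)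
      moreover have "(1 / m) powr p = m powr (- p)" using m by (simp add: powr_divide powr_minus_divide)
      ultimately show ?thesis by linarith
    qed
    have "2 ^ card J * m powr (- p) = (\<Sum>\<epsilon>\<in>signs J. m powr (- p))" using fin by (simp add: card_signs)
    also have "\<dots> \<le> (\<Sum>\<epsilon>\<in>signs J. g \<epsilon> i + g (flip J s \<epsilon>) i)" by (intro sum_mono pair)
    also have "\<dots> = 2 * (\<Sum>\<epsilon>\<in>signs J. g \<epsilon> i)"
      using sum_signs_flip[of J s "\<lambda>\<epsilon>. g \<epsilon> i"] by (simp add: s_def sum.distrib)
    finally show ?thesis .
  qed
  have "(\<Sum>i\<in>J. 2 ^ card J * m powr (- p)) \<le> (\<Sum>i\<in>J. 2 * (\<Sum>\<epsilon>\<in>signs J. g \<epsilon> i))"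
    by (intro sum_mono each)
  also have "(\<Sum>i\<in>J. 2 * (\<Sum>\<epsilon>\<in>signs J. g \<epsilon> i)) = 2 * (\<Sum>\<epsilon>\<in>signs J. \<Sum>i\<in>J. g \<epsilon> i)"
    unfolding sum_distrib_left[symmetric] by (subst sum.swap) (rule refl)
  also have "(\<Sum>i\<in>J. 2 ^ card J * m powr (- p)) = 2 ^ card J * m powr (1 - p)"
    by (simp add: m_def[symmetric] powr_diff powr_minus_divide) (simp add: m_def)
  finally have total: "(\<Sum>\<epsilon>\<in>signs J. m powr (1 - p) / 2) \<le> (\<Sum>\<epsilon>\<in>signs J. \<Sum>i\<in>J. g \<epsilon> i)"
    using fin by (simp add: card_signs)
  have "\<exists>\<epsilon>\<in>signs J. m powr (1 - p) / 2 \<le> (\<Sum>i\<in>J. g \<epsilon> i)"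
  proof (rule ccontr)
    assume "\<not> ?thesis"
    then have "(\<Sum>\<epsilon>\<in>signs J. \<Sum>i\<in>J. g \<epsilon> i) < (\<Sum>\<epsilon>\<in>signs J. m powr (1 - p) / 2)"
      using fin by (intro sum_strict_mono) (auto simp: finite_signs signs_nonempty not_le)
    with total show False by simp
  qed
  then obtain \<epsilon> where \<epsilon>: "\<epsilon> \<in> signs J" "m powr (1 - p) / 2 \<le> (\<Sum>i\<in>J. g \<epsilon> i)" by blast
  show thesis
  proof (rule that)
    show "A \<epsilon> \<in> bilinear_forms smul" unfolding A_def by (rule bilinear_form_from_functionals(1)[OF \<phi>])
    show "norm (A \<epsilon> u v) \<le> norm u * norm v" for u v
    proof -
      have "(\<Sum>i\<in>J. \<bar>\<epsilon> i / m\<bar>) = (\<Sum>i\<in>J. 1 / m)"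
        using signsD[OF \<epsilon>(1)] by (intro sum.cong) (force simp: m_def)+
      also have "\<dots> \<le> 1" by (simp add: m_def)
      finally have "(\<Sum>i\<in>J. \<bar>\<epsilon> i / m\<bar>) * (norm u * norm v) \<le> 1 * (norm u * norm v)"
        by (intro mult_right_mono) auto
      moreover have "norm (A \<epsilon> u v) \<le> (\<Sum>i\<in>J. \<bar>\<epsilon> i / m\<bar>) * (norm u * norm v)"
        unfolding A_def by (rule bilinear_form_from_functionals(2)[OF \<phi>])
      ultimately show ?thesis by simp
    qed
    show "card J powr (1 - p) / 2 \<le> (\<Sum>i\<in>J. norm (A \<epsilon> (x i) (x i)) powr p)"
      using \<epsilon>(2) by (simp add: m_def g_def)
  qed
qed

text \<open>For \<open>m\<close> vectors as in \<open>upper_estimates\<close>, the weak \<open>r\<close>-sums are at most of order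
  \<open>m powr (1 - r / 2 - \<kappa>)\<close> with some \<open>\<kappa> > 0\<close>, whereas the diagonal sums of a suitable
  form of norm at most 1 have order \<open>m powr (1 - r / 2)\<close>. So no inequality between the two can hold
  with a constant independent of \<open>m\<close>.\<close>

lemma undominated_blocks:
  fixes smul :: "'k::real_normed_field \<Rightarrow> 'a::real_normed_vector \<Rightarrow> 'a"
  assumes cot: "2 < cotype_inf TYPE('a)" and r: "0 < r" "r < 2"
    and weak: "\<And>\<phi> B x. \<phi> \<in> dual_unit_ball smul \<Longrightarrow> finite B \<Longrightarrow> (\<Sum>i\<in>B. norm (\<phi> (x i))) \<le> 2 * max_signed x B"
    and norming: "\<And>x. \<exists>\<phi>\<in>dual_unit_ball smul. norm (\<phi> x) = norm x"
  shows "\<exists>J (z :: nat \<Rightarrow> 'a). \<exists>A\<in>bilinear_forms smul. finite J \<and> (\<forall>u v. norm (A u v) \<le> norm u * norm v) \<and>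
    (\<forall>\<phi>\<in>dual_unit_ball smul. (\<Sum>i\<in>J. norm (\<phi> (z i)) powr r) \<le> 1) \<and>
    M \<le> (\<Sum>i\<in>J. norm (A (z i) (z i)) powr (r / 2))"
proof -
  obtain b0 where b0: "0 \<le> b0" "b0 < 1 / 2"
    and ex: "\<And>\<delta>. 0 < \<delta> \<Longrightarrow> \<exists>C>0. \<forall>M::nat. \<exists>J (x :: nat \<Rightarrow> 'a). finite J \<and> M \<le> card J \<and> (\<forall>i\<in>J. 1 \<le> norm (x i)) \<and>
       (\<forall>B\<subseteq>J. max_signed x B \<le> C * card J powr \<delta> * card B powr b0)"
    using upper_estimates[OF cot] by metis
  \<comment> \<open>Enlarging the exponent \<open>b0\<close> to \<open>b\<close> makes \<open>s = r * (1 - b)\<close> smaller than 1,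
    where the sums of \<open>j powr (- s)\<close> grow like powers.\<close>
  have "1 - 1 / r < 1 / 2" using r by (simp add: field_simps)
  then have "max b0 (1 - 1 / r) < 1 / 2" using b0 by (intro max_less_iff_conj[THEN iffD2] conjI)
  then obtain b where b: "max b0 (1 - 1 / r) < b" "b < 1 / 2" using dense by blast
  define s where "s = r * (1 - b)"
  have s: "s < 1" using b r by (simp add: s_def field_simps)
  \<comment> \<open>Half of the room between \<open>b\<close> and \<open>1 / 2\<close> pays for the factor \<open>m powr \<delta>\<close>; the other
    half is the gain \<open>\<kappa>\<close>.\<close>
  define \<delta> where "\<delta> = (1 / 2 - b) / 2"
  define \<kappa> where "\<kappa> = r * \<delta>"
  have \<delta>: "0 < \<delta>" and \<kappa>: "0 < \<kappa>" using b r by (auto simp: \<delta>_def \<kappa>_def)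
  obtain C where C: "0 < C" and exC: "\<And>M::nat. \<exists>J (x :: nat \<Rightarrow> 'a). finite J \<and> M \<le> card J \<and> (\<forall>i\<in>J. 1 \<le> norm (x i)) \<and>
       (\<forall>B\<subseteq>J. max_signed x B \<le> C * card J powr \<delta> * card B powr b0)"
    using ex[OF \<delta>] by blast
  define E where "E = (2 * C) powr r / (1 - s)"
  have E: "0 < E" using C s by (simp add: E_def)
  obtain n :: nat where n: "(2 * E * max M 0) powr (1 / \<kappa>) \<le> n" using real_arch_simple by blast
  obtain J and x :: "nat \<Rightarrow> 'a" where J: "finite J" "max 1 n \<le> card J" "\<And>i. i \<in> J \<Longrightarrow> 1 \<le> norm (x i)"
    and up: "\<And>B. B \<subseteq> J \<Longrightarrow> max_signed x B \<le> C * card J powr \<delta> * card B powr b0"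
    using exC[of "max 1 n"] by metis
  define m where "m = real (card J)"
  have m: "1 \<le> m" "n \<le> m" using J(2) by (auto simp: m_def)
  define V where "V = E * m powr (1 - r / 2 - \<kappa>)"
  have V: "0 < V" using E m by (simp add: V_def)
  have sumV: "(\<Sum>i\<in>J. norm (\<phi> (x i)) powr r) \<le> V" if \<phi>: "\<phi> \<in> dual_unit_ball smul" for \<phi>
  proof -
    define L where "L = 2 * C * m powr \<delta>"
    have L: "0 < L" using C m by (simp add: L_def)
    have "(\<Sum>i\<in>J. norm (\<phi> (x i)) powr r) \<le> L powr r * (card J powr (1 - r * (1 - b)) / (1 - r * (1 - b)))"
    proof (rule sum_powr_of_subset_sums)
      show "(\<Sum>i\<in>B. norm (\<phi> (x i))) \<le> L * card B powr b" if B: "B \<subseteq> J" "B \<noteq> {}" for B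
      proof -
        have finB: "finite B" using finite_subset[OF B(1) J(1)] .
        have cB: "1 \<le> card B" using finB B by (simp add: Suc_leI card_gt_0_iff)
        have "(\<Sum>i\<in>B. norm (\<phi> (x i))) \<le> 2 * max_signed x B" by (rule weak[OF \<phi> finB])
        also have "\<dots> \<le> L * card B powr b0" using up[OF B(1)] by (simp add: L_def m_def mult_ac)
        also have "\<dots> \<le> L * card B powr b" using L cB b by (intro mult_left_mono powr_mono) auto
        finally show ?thesis .
      qed
    qed (use J r b s L in \<open>auto simp: s_def\<close>)
    also have "\<dots> = E * (m powr \<kappa> * m powr (1 - s))"
      using C m by (simp add: L_def E_def s_def[symmetric] m_def[symmetric] powr_mult powr_powr \<kappa>_def mult_ac)
    also have "m powr \<kappa> * m powr (1 - s) = m powr (1 - r / 2 - \<kappa>)"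
    proof -
      have "\<kappa> + (1 - s) = 1 - r / 2 - \<kappa>" by (simp add: \<kappa>_def s_def \<delta>_def field_simps)
      then show ?thesis by (simp only: powr_add[symmetric])
    qed
    finally show ?thesis by (simp add: V_def)
  qed
  have "\<forall>i. \<exists>\<phi>. \<phi> \<in> dual_unit_ball smul \<and> norm (\<phi> (x i)) = norm (x i)" using norming by blast
  then obtain \<phi> where \<phi>: "\<And>i. \<phi> i \<in> dual_unit_ball smul" "\<And>i. norm (\<phi> i (x i)) = norm (x i)" by metis
  obtain A where A: "A \<in> bilinear_forms smul" "\<And>u v. norm (A u v) \<le> norm u * norm v"
    "m powr (1 - r / 2) / 2 \<le> (\<Sum>i\<in>J. norm (A (x i) (x i)) powr (r / 2))"
    using bilinear_form_large_on_diagonal[of "r / 2" J \<phi> smul x] r J \<phi> unfolding m_def by auto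
  interpret A: bounded_bilinear A using A(1) by (simp add: bilinear_forms_def)
  define z where "z i = V powr (- 1 / r) *\<^sub>R x i" for i
  show ?thesis
  proof (intro exI bexI conjI ballI allI)
    show "A \<in> bilinear_forms smul" "norm (A u v) \<le> norm u * norm v" "finite J" for u v
      using A J by auto
    show "(\<Sum>i\<in>J. norm (\<psi> (z i)) powr r) \<le> 1" if \<psi>: "\<psi> \<in> dual_unit_ball smul" for \<psi>
    proof -
      have "norm (\<psi> (z i)) powr r = norm (\<psi> (x i)) powr r / V" for i
        using r V bounded_linear.linear[OF dual_unit_ball_bounded_linear[OF \<psi>]]
        by (simp add: z_def linear_scale powr_mult powr_divide powr_powr powr_minus_divide)
      then have "(\<Sum>i\<in>J. norm (\<psi> (z i)) powr r) = (\<Sum>i\<in>J. norm (\<psi> (x i)) powr r) / V"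
        by (simp add: sum_divide_distrib)
      then show ?thesis using sumV[OF \<psi>] V by simp
    qed
    show "M \<le> (\<Sum>i\<in>J. norm (A (z i) (z i)) powr (r / 2))"
    proof -
      have "norm (A (z i) (z i)) powr (r / 2) = norm (A (x i) (x i)) powr (r / 2) / V" for i
      proof -
        have "norm (A (z i) (z i)) = V powr (- 2 / r) * norm (A (x i) (x i))"
          by (simp add: z_def A.scaleR_left A.scaleR_right powr_add[symmetric] mult.assoc[symmetric])
        then show ?thesis using r V by (simp add: powr_mult powr_divide powr_powr powr_minus_divide)
      qed
      then have eq: "(\<Sum>i\<in>J. norm (A (z i) (z i)) powr (r / 2)) = (\<Sum>i\<in>J. norm (A (x i) (x i)) powr (r / 2)) / V"
        by (simp add: sum_divide_distrib)
      have "2 * E * max M 0 = ((2 * E * max M 0) powr (1 / \<kappa>)) powr \<kappa>" using \<kappa> E by (simp add: powr_powr)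
      also have "\<dots> \<le> m powr \<kappa>" using n m \<kappa> by (intro powr_mono2) auto
      finally have "2 * E * max M 0 \<le> m powr \<kappa>" .
      moreover have "M * (2 * E) \<le> max M 0 * (2 * E)" using E by (intro mult_right_mono) auto
      ultimately have "M * (2 * E) \<le> m powr \<kappa>" by (simp only: mult.commute)
      then have "M \<le> m powr \<kappa> / (2 * E)" using E by (simp add: pos_le_divide_eq)
      also have "\<dots> = (m powr (1 - r / 2) / 2) / V"
      proof -
        have "m powr (1 - r / 2) = m powr \<kappa> * m powr (1 - r / 2 - \<kappa>)" by (simp add: powr_add[symmetric])
        then show ?thesis using m E by (simp add: V_def)
      qed
      also have "\<dots> \<le> (\<Sum>i\<in>J. norm (A (z i) (z i)) powr (r / 2))"
        unfolding eq using A(3) V by (intro divide_right_mono) auto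
      finally show ?thesis .
    qed
  qed
qed

section \<open>Gluing finite blocks\<close>

text \<open>The uniform boundedness principle via Baire's theorem. Seminorms would not suffice, since the
  functionals of interest are sums of powers with an exponent below 1; subadditivity and symmetry are
  what the usual argument uses.\<close>

lemma subadditive_uniform_boundedness:
  fixes V :: "'v::banach set" and N :: "nat \<Rightarrow> 'v \<Rightarrow> real"
  assumes V: "closed V" "subspace V" and cont: "\<And>k. continuous_on UNIV (N k)"
    and add: "\<And>k u v. N k (u + v) \<le> N k u + N k v" and minus: "\<And>k v. N k (- v) = N k v"
    and bdd: "\<And>v. v \<in> V \<Longrightarrow> \<exists>B. \<forall>k. N k v \<le> B"
  obtains \<rho> B where "0 < \<rho>" "\<And>k v. v \<in> V \<Longrightarrow> norm v \<le> \<rho> \<Longrightarrow> N k v \<le> B"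
proof -
  define E where "E m = {v\<in>V. \<forall>k. N k v \<le> real m}" for m :: nat
  define X where "X = top_of_set V"
  have "completely_metrizable_space X"
    unfolding X_def by (intro completely_metrizable_space_closedin[OF completely_metrizable_space_euclidean]) (simp add: V)
  have Vunion: "\<Union>(range E) = topspace X"
  proof
    show "topspace X \<subseteq> \<Union>(range E)"
    proof
      fix v assume "v \<in> topspace X"
      then have v: "v \<in> V" by (simp add: X_def)
      obtain B where B: "\<And>k. N k v \<le> B" using bdd[OF v] by blast
      obtain m :: nat where "B \<le> m" using real_arch_simple by blast
      then have "v \<in> E m" using B v by (auto simp: E_def intro: order_trans)
      then show "v \<in> \<Union>(range E)" by blast
    qed
  qed (auto simp: E_def X_def)
  have closed: "closedin X (E m)" for m
  proof -
    have "closed (\<Inter>k. {v. N k v \<le> real m})"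
      by (intro closed_INT ballI closed_Collect_le cont continuous_on_const)
    moreover have "E m = V \<inter> (\<Inter>k. {v. N k v \<le> real m})" by (auto simp: E_def)
    ultimately show ?thesis unfolding X_def by (auto simp: closedin_closed)
  qed
  have "\<exists>m. X interior_of (E m) \<noteq> {}"
  proof (rule ccontr)
    assume none: "\<not> ?thesis"
    have "X interior_of \<Union>(range E) = {}"
      by (rule Baire_category_alt) (use \<open>completely_metrizable_space X\<close> closed none in auto)
    then have "topspace X = {}" unfolding Vunion interior_of_topspace .
    then have "V = {}" by (simp add: X_def)
    then show False using subspace_0[OF V(2)] by simp
  qed
  then obtain m u where "u \<in> X interior_of (E m)" by blast
  then obtain T where T: "openin X T" "u \<in> T" "T \<subseteq> E m" by (auto simp: interior_of_def)
  then obtain e where e: "0 < e" "ball u e \<inter> V \<subseteq> T" and uV: "u \<in> V"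
    unfolding X_def openin_contains_ball by blast
  show thesis
  proof (rule that[of "e / 2" "2 * real m"])
    show "N k v \<le> 2 * real m" if v: "v \<in> V" "norm v \<le> e / 2" for k v
    proof -
      have "u + v \<in> V" using V(2) uV v(1) by (rule subspace_add)
      moreover have "u + v \<in> ball u e" using v(2) e(1) by (simp add: dist_norm)
      ultimately have "u + v \<in> E m" using e T by blast
      then have "N k (u + v) \<le> m" by (simp add: E_def)
      moreover have "N k u \<le> m" using T by (auto simp: E_def)
      moreover have "N k v \<le> N k (u + v) + N k u" using add[of k "u + v" "- u"] minus[of k u] by simp
      ultimately show ?thesis by linarith
    qed
  qed (use e in simp)
qed

text \<open>After division by \<open>a + b\<close> this says that \<open>t \<le> t powr p\<close> on the unit interval.\<close>

lemma powr_subadditive: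
  fixes a b p :: real
  assumes "0 \<le> a" "0 \<le> b" "0 < p" "p \<le> 1"
  shows "(a + b) powr p \<le> a powr p + b powr p"
proof (cases "a + b = 0")
  case False
  define c where "c = a + b"
  have c: "0 < c" using False assms by (simp add: c_def)
  have le: "t / c \<le> (t / c) powr p" if "0 \<le> t" "t \<le> c" for t
    using powr_mono'[of p 1 "t / c"] that assms c by (cases "t = 0") auto
  have "1 = a / c + b / c" using c by (simp add: c_def flip: add_divide_distrib)
  also have "\<dots> \<le> (a / c) powr p + (b / c) powr p" using assms by (intro add_mono le) (auto simp: c_def)
  also have "\<dots> = (a powr p + b powr p) / c powr p" using assms c by (simp add: powr_divide add_divide_distrib)
  finally show ?thesis using c by (simp add: c_def[symmetric] field_simps)
qed (use assms in auto)

text \<open>Bounded bilinear maps become elements of a Banach space, to which Baire's theorem can be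
  applied.\<close>

lemma blinfun_of_bilinear:
  fixes A :: "'a::real_normed_vector \<Rightarrow> 'b::real_normed_vector \<Rightarrow> 'c::real_normed_vector"
  assumes A: "bounded_bilinear A" and le: "\<And>u v. norm (A u v) \<le> norm u * norm v"
  obtains B :: "'a \<Rightarrow>\<^sub>L 'b \<Rightarrow>\<^sub>L 'c" where "norm B \<le> 1" "\<And>u v. blinfun_apply (blinfun_apply B u) v = A u v"
proof -
  interpret A: bounded_bilinear A by (rule A)
  define g where "g u = Blinfun (A u)" for u
  have g: "blinfun_apply (g u) v = A u v" for u v
    unfolding g_def by (simp add: bounded_linear_Blinfun_apply A.bounded_linear_right)
  have ng: "norm (g u) \<le> norm u" for u
    by (rule norm_blinfun_bound) (simp_all add: g le)
  have "bounded_linear g"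
  proof (rule bounded_linear_intro[where K=1])
    show "g (u + v) = g u + g v" for u v by (rule blinfun_eqI) (simp add: g A.add_left blinfun.add_left)
    show "g (c *\<^sub>R u) = c *\<^sub>R g u" for c u by (rule blinfun_eqI) (simp add: g A.scaleR_left blinfun.scaleR_left)
    show "norm (g u) \<le> norm u * 1" for u using ng by simp
  qed
  then have B: "blinfun_apply (Blinfun g) u = g u" for u by (simp add: bounded_linear_Blinfun_apply)
  show thesis
  proof (rule that)
    show "norm (Blinfun g) \<le> 1" by (rule norm_blinfun_bound) (simp_all add: B ng)
  qed (simp add: B g)
qed

lemma sum_prod_decode_le:
  fixes g :: "nat \<times> nat \<Rightarrow> real"
  assumes pos: "\<And>p. 0 \<le> g p" and supp: "\<And>k i. i \<notin> J k \<Longrightarrow> g (k, i) = 0" and fin: "\<And>k. finite (J k)"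
  shows "(\<Sum>j<n. g (prod_decode j)) \<le> (\<Sum>k<n. \<Sum>i\<in>J k. g (k, i))"
proof -
  define D where "D = prod_decode ` {..<n}"
  have "(\<Sum>j<n. g (prod_decode j)) = (\<Sum>p\<in>D. g p)"
    unfolding D_def by (subst sum.reindex) (auto simp: inj_on_def)
  also have "\<dots> = (\<Sum>p\<in>D \<inter> Sigma {..<n} J. g p)"
  proof (rule sum.mono_neutral_right)
    show "\<forall>p\<in>D - D \<inter> Sigma {..<n} J. g p = 0"
    proof
      fix p assume p: "p \<in> D - D \<inter> Sigma {..<n} J"
      then obtain j where j: "j < n" "p = prod_decode j" by (auto simp: D_def)
      have "prod_encode (fst p, snd p) < n" using j by simp
      then have "fst p < n" using le_prod_encode_1[of "fst p" "snd p"] by linarith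
      then have "snd p \<notin> J (fst p)" using p by (cases p) auto
      then show "g p = 0" using supp[of "snd p" "fst p"] by simp
    qed
  qed (auto simp: D_def)
  also have "\<dots> \<le> (\<Sum>p\<in>Sigma {..<n} J. g p)"
    using fin pos by (intro sum_mono2) auto
  also have "\<dots> = (\<Sum>k<n. \<Sum>i\<in>J k. g (k, i))"
    using fin by (subst sum.Sigma) auto
  finally show ?thesis .
qed

text \<open>The \<open>k\<close>-th block is scaled so that its weak \<open>r\<close>-sum is at most \<open>1 / 2 ^ k\<close>, and all
  blocks are strung together along the pairing function into one weakly summable sequence
  \<open>x\<close>. If every form were \<open>r\<close>-dominated, then the diagonal sums over the blocks would be bounded
  for each form, hence uniformly bounded on a ball of forms; but on the \<open>k\<close>-th block they exceed a
  fixed multiple of \<open>2 ^ k\<close>.\<close>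

lemma undominated_form_exists:
  fixes smul :: "'k::{real_normed_field, banach} \<Rightarrow> 'a::banach \<Rightarrow> 'a"
  assumes r: "0 < r" "r < 2"
    and blocks: "\<And>M. \<exists>J (z :: nat \<Rightarrow> 'a). \<exists>A\<in>bilinear_forms smul. finite J \<and>
      (\<forall>u v. norm (A u v) \<le> norm u * norm v) \<and>
      (\<forall>\<phi>\<in>dual_unit_ball smul. (\<Sum>i\<in>J. norm (\<phi> (z i)) powr r) \<le> 1) \<and>
      M \<le> (\<Sum>i\<in>J. norm (A (z i) (z i)) powr (r / 2))"
  shows "dominated_forms smul r \<noteq> bilinear_forms smul"
proof
  assume all: "dominated_forms smul r = bilinear_forms smul"
  define good where "good k J z A \<longleftrightarrow> A \<in> bilinear_forms smul \<and> finite J \<and> (\<forall>u v. norm (A u v) \<le> norm u * norm v) \<and>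
      (\<forall>\<phi>\<in>dual_unit_ball smul. (\<Sum>i\<in>J. norm (\<phi> (z i)) powr r) \<le> 1) \<and>
      4 ^ k \<le> (\<Sum>i\<in>J. norm (A (z i) (z i)) powr (r / 2))" for k J and z :: "nat \<Rightarrow> 'a" and A
  have "\<exists>J z A. good k J z A" for k :: nat
    using blocks[of "4 ^ k"] unfolding good_def by (elim exE bexE conjE) (intro exI conjI; assumption)
  then obtain J z A where "\<And>k. good k (J k) (z k) (A k)" by metis
  then have JzA: "A k \<in> bilinear_forms smul" "finite (J k)" "norm (A k u v) \<le> norm u * norm v"
    "\<phi> \<in> dual_unit_ball smul \<Longrightarrow> (\<Sum>i\<in>J k. norm (\<phi> (z k i)) powr r) \<le> 1"
    "4 ^ k \<le> (\<Sum>i\<in>J k. norm (A k (z k i) (z k i)) powr (r / 2))" for k u v \<phi>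
    unfolding good_def by auto
  define y where "y p = (if snd p \<in> J (fst p) then (1 / 2 ^ fst p) powr (1 / r) *\<^sub>R z (fst p) (snd p) else 0)" for p
  define x where "x j = y (prod_decode j)" for j
  have "weakly_summable smul r x"
    unfolding weakly_summable_def
  proof (intro exI ballI conjI)
    fix \<phi> assume \<phi>: "\<phi> \<in> dual_unit_ball smul"
    have lin: "linear \<phi>" using bounded_linear.linear[OF dual_unit_ball_bounded_linear[OF \<phi>]] .
    define g where "g p = norm (\<phi> (y p)) powr r" for p
    have gk: "g (k, i) = 1 / 2 ^ k * norm (\<phi> (z k i)) powr r" if "i \<in> J k" for k i
      using that r by (simp add: g_def y_def linear_scale[OF lin] powr_mult powr_powr)
    have bound: "(\<Sum>j<n. norm (\<phi> (x j)) powr r) \<le> 2" for n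
    proof -
      have "(\<Sum>j<n. norm (\<phi> (x j)) powr r) \<le> (\<Sum>k<n. \<Sum>i\<in>J k. g (k, i))"
        unfolding x_def g_def[symmetric]
        by (rule sum_prod_decode_le) (auto simp: g_def y_def JzA(2) linear_0[OF lin])
      also have "\<dots> \<le> (\<Sum>k<n. 1 / 2 ^ k)"
      proof (rule sum_mono)
        fix k
        have "(\<Sum>i\<in>J k. g (k, i)) = 1 / 2 ^ k * (\<Sum>i\<in>J k. norm (\<phi> (z k i)) powr r)"
          by (simp add: gk sum_distrib_left)
        also have "\<dots> \<le> 1 / 2 ^ k * 1" using JzA(4)[OF \<phi>] by (intro mult_left_mono) auto
        finally show "(\<Sum>i\<in>J k. g (k, i)) \<le> 1 / 2 ^ k" by simp
      qed
      also have "\<dots> = (\<Sum>k<n. (1 / 2) ^ k)" by (simp add: power_one_over)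
      also have "\<dots> \<le> 2" by (simp add: geometric_sum)
      finally show ?thesis .
    qed
    show sm: "summable (\<lambda>j. norm (\<phi> (x j)) powr r)"
      by (rule summableI_nonneg_bounded[OF _ bound]) simp
    have "(\<Sum>j. norm (\<phi> (x j)) powr r) \<le> 2" using sm bound by (rule suminf_le_const)
    then show "(\<Sum>j. norm (\<phi> (x j)) powr r) powr (1 / r) \<le> 2 powr (1 / r)"
      using r sm by (intro powr_mono2 suminf_nonneg) auto
  qed
  define V :: "('a \<Rightarrow>\<^sub>L 'a \<Rightarrow>\<^sub>L 'k) set" where
    "V = {B. \<forall>c u v. blinfun_apply (blinfun_apply B (smul c u)) v = c * blinfun_apply (blinfun_apply B u) v \<and>
       blinfun_apply (blinfun_apply B u) (smul c v) = c * blinfun_apply (blinfun_apply B u) v}"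
  define N where "N k B = (\<Sum>i\<in>J k. norm (blinfun_apply (blinfun_apply B (y (k, i))) (y (k, i))) powr (r / 2))"
    for k and B :: "'a \<Rightarrow>\<^sub>L 'a \<Rightarrow>\<^sub>L 'k"
  have bilin: "(\<lambda>u v. blinfun_apply (blinfun_apply B u) v) \<in> bilinear_forms smul" if "B \<in> V" for B
  proof -
    have "bounded_bilinear (\<lambda>u v. blinfun_apply (blinfun_apply B u) v)"
      by (rule bounded_bilinear.comp1[OF bounded_bilinear_blinfun_apply blinfun.bounded_linear_right])
    then show ?thesis using that by (simp add: bilinear_forms_def V_def)
  qed
  have N_bounded: "\<exists>b. \<forall>k. N k B \<le> b" if "B \<in> V" for B
  proof (intro exI allI)
    fix k
    define h where "h j = norm (blinfun_apply (blinfun_apply B (x j)) (x j)) powr (r / 2)" for j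
    have sm: "summable h"
    proof -
      have "(\<lambda>u v. blinfun_apply (blinfun_apply B u) v) \<in> dominated_forms smul r" using bilin[OF that] all by simp
      then show ?thesis using \<open>weakly_summable smul r x\<close> by (simp add: dominated_forms_def h_def[abs_def])
    qed
    have "N k B = (\<Sum>j\<in>(\<lambda>i. prod_encode (k, i)) ` J k. h j)"
      by (subst sum.reindex) (auto simp: N_def h_def x_def inj_on_def)
    also have "\<dots> \<le> suminf h" using JzA(2) by (intro sum_le_suminf sm) (auto simp: h_def)
    finally show "N k B \<le> suminf h" .
  qed
  obtain \<rho> b where \<rho>: "0 < \<rho>" and b: "\<And>k B. B \<in> V \<Longrightarrow> norm B \<le> \<rho> \<Longrightarrow> N k B \<le> b"
  proof (rule subadditive_uniform_boundedness[of V N])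
    show "closed V" unfolding V_def
      by (intro closed_Collect_all closed_Collect_conj closed_Collect_eq continuous_intros)
    show "subspace V"
      by (auto simp: subspace_def V_def blinfun.add_left blinfun.scaleR_left algebra_simps)
    show "continuous_on UNIV (N k)" for k
      unfolding N_def using r by (intro continuous_on_sum continuous_on_powr' continuous_intros) auto
    show "N k (B + B') \<le> N k B + N k B'" for k B B'
      unfolding N_def sum.distrib[symmetric]
    proof (rule sum_mono)
      fix i
      let ?u = "blinfun_apply (blinfun_apply B (y (k, i))) (y (k, i))"
      let ?v = "blinfun_apply (blinfun_apply B' (y (k, i))) (y (k, i))"
      have "norm (?u + ?v) powr (r / 2) \<le> (norm ?u + norm ?v) powr (r / 2)"
        using r by (intro powr_mono2 norm_triangle_ineq) auto
      also have "\<dots> \<le> norm ?u powr (r / 2) + norm ?v powr (r / 2)"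
        using r by (intro powr_subadditive) auto
      finally show "norm (blinfun_apply (blinfun_apply (B + B') (y (k, i))) (y (k, i))) powr (r / 2)
          \<le> norm ?u powr (r / 2) + norm ?v powr (r / 2)" by (simp add: blinfun.add_left)
    qed
    show "N k (- B) = N k B" for k B by (simp add: N_def blinfun.minus_left)
  qed (use N_bounded in auto)
  have unbounded: "\<rho> powr (r / 2) * 2 ^ k \<le> b" for k
  proof -
    obtain B :: "'a \<Rightarrow>\<^sub>L 'a \<Rightarrow>\<^sub>L 'k" where B: "norm B \<le> 1" "\<And>u v. blinfun_apply (blinfun_apply B u) v = A k u v"
      using blinfun_of_bilinear[of "A k"] JzA(1,3) by (auto simp: bilinear_forms_def)
    interpret A: bounded_bilinear "A k" using JzA(1) by (simp add: bilinear_forms_def)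
    have "B \<in> V" using JzA(1)[of k] by (auto simp: V_def B bilinear_forms_def)
    then have "\<rho> *\<^sub>R B \<in> V" by (simp add: V_def blinfun.scaleR_left)
    moreover have "norm (\<rho> *\<^sub>R B) \<le> \<rho>" using B(1) \<rho> by (simp add: mult_left_le)
    ultimately have "N k (\<rho> *\<^sub>R B) \<le> b" by (rule b)
    moreover have "N k (\<rho> *\<^sub>R B) = \<rho> powr (r / 2) / 2 ^ k * (\<Sum>i\<in>J k. norm (A k (z k i) (z k i)) powr (r / 2))"
    proof -
      have "norm (blinfun_apply (blinfun_apply (\<rho> *\<^sub>R B) (y (k, i))) (y (k, i))) powr (r / 2)
          = \<rho> powr (r / 2) / 2 ^ k * norm (A k (z k i) (z k i)) powr (r / 2)" if "i \<in> J k" for i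
      proof -
        have "norm (blinfun_apply (blinfun_apply (\<rho> *\<^sub>R B) (y (k, i))) (y (k, i)))
            = \<rho> * ((1 / 2 ^ k) powr (2 / r) * norm (A k (z k i) (z k i)))"
          using that \<rho> by (simp add: blinfun.scaleR_left B y_def A.scaleR_left A.scaleR_right powr_add[symmetric] mult.assoc[symmetric])
        also have "\<dots> powr (r / 2) = \<rho> powr (r / 2) * (1 / 2 ^ k * norm (A k (z k i) (z k i)) powr (r / 2))"
          using \<rho> r by (simp add: powr_mult powr_powr)
        finally show ?thesis by simp
      qed
      then show ?thesis by (simp add: N_def sum_distrib_left)
    qed
    moreover have "\<rho> powr (r / 2) / 2 ^ k * 4 ^ k
        \<le> \<rho> powr (r / 2) / 2 ^ k * (\<Sum>i\<in>J k. norm (A k (z k i) (z k i)) powr (r / 2))"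
      using JzA(5)[of k] by (intro mult_left_mono) auto
    moreover have "\<rho> powr (r / 2) / 2 ^ k * 4 ^ k = \<rho> powr (r / 2) * 2 ^ k"
    proof -
      have "(4::real) ^ k = 2 ^ k * 2 ^ k" by (simp flip: power_mult_distrib)
      then show ?thesis by simp
    qed
    ultimately show ?thesis by linarith
  qed
  obtain k where "b / \<rho> powr (r / 2) < 2 ^ k" using real_arch_pow[of 2] by auto
  then have "b < \<rho> powr (r / 2) * 2 ^ k" using \<rho> by (simp add: field_simps)
  with unbounded[of k] show False by simp
qed

section \<open>Real and complex scalars\<close>

text \<open>The scalar field enters only through \<open>weak\<close> and \<open>norming\<close>. The constant 2 in
  \<open>weak\<close> leaves room for the real and the imaginary part of a complex functional.\<close>

lemma domination_index_ge_2:
  fixes smul :: "'k::{real_normed_field, banach} \<Rightarrow> 'a::banach \<Rightarrow> 'a"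
  assumes cot: "2 < cotype_inf TYPE('a)"
    and weak: "\<And>\<phi> B x. \<phi> \<in> dual_unit_ball smul \<Longrightarrow> finite B \<Longrightarrow> (\<Sum>i\<in>B. norm (\<phi> (x i))) \<le> 2 * max_signed x B"
    and norming: "\<And>x. \<exists>\<phi>\<in>dual_unit_ball smul. norm (\<phi> x) = norm x"
  shows "2 \<le> domination_index smul"
  unfolding domination_index_def
proof (rule Inf_greatest)
  fix q assume "q \<in> {ereal r | r. 0 < r \<and> dominated_forms smul r = bilinear_forms smul}"
  then obtain r where r: "q = ereal r" "0 < r" "dominated_forms smul r = bilinear_forms smul" by auto
  have "\<not> r < 2"
  proof
    assume "r < 2"
    have "dominated_forms smul r \<noteq> bilinear_forms smul"
      by (rule undominated_form_exists[OF r(2) \<open>r < 2\<close>]) (rule undominated_blocks[OF cot r(2) \<open>r < 2\<close> weak norming])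
    with r(3) show False by contradiction
  qed
  then show "2 \<le> q" using r(1) by (simp add: numeral_eq_ereal)
qed

lemma dual_unit_ball_real: "dual_unit_ball ((*\<^sub>R) :: real \<Rightarrow> 'a::real_normed_vector \<Rightarrow> 'a) = dual_ball"
proof (rule set_eqI)
  fix f :: "'a \<Rightarrow> real"
  show "f \<in> dual_unit_ball (*\<^sub>R) \<longleftrightarrow> f \<in> dual_ball"
  proof
    assume f: "f \<in> dual_unit_ball (*\<^sub>R)"
    then show "f \<in> dual_ball"
      using bounded_linear.linear[OF dual_unit_ball_bounded_linear[OF f]] dual_unit_ball_norm_le[OF f]
      by (auto simp: dual_ball_def intro: order_trans[OF abs_ge_self])
  next
    assume f: "f \<in> dual_ball"
    have "bounded_linear f"
      using dual_ball_linear[OF f] dual_ball_abs_le[OF f]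
      by (intro bounded_linear_intro[where K=1]) (auto simp: linear_add linear_scale)
    moreover have "onorm f \<le> 1" using dual_ball_abs_le[OF f] by (intro onorm_bound) auto
    ultimately show "f \<in> dual_unit_ball (*\<^sub>R)"
      using dual_ball_linear[OF f] by (simp add: dual_unit_ball_def linear_scale)
  qed
qed


lemma complex_dual_ball_parts:
  fixes smul :: "complex \<Rightarrow> 'a::banach \<Rightarrow> 'a"
  assumes \<phi>: "\<phi> \<in> dual_unit_ball smul"
  shows "(\<lambda>y. Re (\<phi> y)) \<in> dual_ball" "(\<lambda>y. Im (\<phi> y)) \<in> dual_ball"
proof -
  have lin: "linear \<phi>" by (rule bounded_linear.linear[OF dual_unit_ball_bounded_linear[OF \<phi>]])
  have "linear (\<lambda>y. Re (\<phi> y))" "linear (\<lambda>y. Im (\<phi> y))"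
    using lin by (auto simp: linear_iff)
  moreover have "Re (\<phi> y) \<le> norm y" "Im (\<phi> y) \<le> norm y" for y
    using dual_unit_ball_norm_le[OF \<phi>, of y] complex_Re_le_cmod[of "\<phi> y"] abs_Im_le_cmod[of "\<phi> y"] by auto
  ultimately show "(\<lambda>y. Re (\<phi> y)) \<in> dual_ball" "(\<lambda>y. Im (\<phi> y)) \<in> dual_ball"
    by (auto simp: dual_ball_def)
qed

text \<open>The complexification \<open>f y - \<i> f (\<i> y)\<close> of a real norming functional \<open>f\<close>.\<close>

lemma complex_norming_functional:
  fixes smul :: "complex \<Rightarrow> 'a::banach \<Rightarrow> 'a"
  assumes "banach_space_over smul"
  shows "\<exists>\<phi>\<in>dual_unit_ball smul. norm (\<phi> x) = norm x"
proof -
  interpret banach_space_over smul by (rule assms)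
  obtain f where f: "f \<in> dual_ball" "f x = norm x" by (rule norming_functional)
  have lin: "linear f" by (rule dual_ball_linear[OF f(1)])
  define \<phi> where "\<phi> y = Complex (f y) (- f (smul \<i> y))" for y
  have smulR: "smul (complex_of_real t) y = t *\<^sub>R y" for t y by (rule scale_of_real)
  have iR: "smul \<i> (t *\<^sub>R y) = t *\<^sub>R smul \<i> y" for t y
    unfolding smulR[symmetric] by (simp add: scale_left_commute)
  have ii: "smul \<i> (smul \<i> y) = - y" for y
  proof -
    have "smul \<i> (smul \<i> y) = smul (complex_of_real (-1)) y" by simp
    then show ?thesis unfolding smulR by simp
  qed
  have split: "smul c y = Re c *\<^sub>R y + Im c *\<^sub>R smul \<i> y" for c y
  proof -
    have "smul c y = smul (complex_of_real (Re c) + complex_of_real (Im c) * \<i>) y"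
      by (simp add: complex_eq[of c, symmetric] mult.commute)
    also have "\<dots> = Re c *\<^sub>R y + Im c *\<^sub>R smul \<i> y"
      unfolding scale_left_distrib scale_scale[symmetric] smulR ..
    finally show ?thesis .
  qed
  have \<phi>c: "\<phi> (smul c y) = c * \<phi> y" for c y
    unfolding split[of c y] by (simp add: \<phi>_def complex_eq_iff scale_right_distrib iR ii linear_add[OF lin] linear_scale[OF lin] linear_neg[OF lin] linear_diff[OF lin])
  \<comment> \<open>Rotating \<open>y\<close> so that \<open>\<phi> y\<close> becomes real and nonnegative reduces the bound on
    \<open>\<phi>\<close> to the one on \<open>f\<close>.\<close>
  have le: "norm (\<phi> y) \<le> norm y" for y
  proof (cases "\<phi> y = 0")
    case False
    define c where "c = cnj (\<phi> y) / norm (\<phi> y)"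
    have c: "norm c = 1" using False by (simp add: c_def norm_divide)
    have "c * \<phi> y = complex_of_real (norm (\<phi> y))"
      using False complex_norm_square[of "\<phi> y"] by (simp add: c_def power2_eq_square divide_eq_eq mult.commute)
    then have "norm (\<phi> y) = Re (\<phi> (smul c y))" by (simp add: \<phi>c)
    also have "\<dots> = f (smul c y)" by (simp add: \<phi>_def)
    also have "\<dots> \<le> norm (smul c y)" by (rule dual_ball_le[OF f(1)])
    finally show ?thesis by (simp add: norm_scale c)
  qed simp
  have add: "\<phi> (u + v) = \<phi> u + \<phi> v" for u v
    by (simp add: \<phi>_def complex_eq_iff scale_right_distrib linear_add[OF lin])
  have "bounded_linear \<phi>"
  proof (rule bounded_linear_intro[where K=1])
    show "\<phi> (t *\<^sub>R u) = t *\<^sub>R \<phi> u" for t u using \<phi>c[of "complex_of_real t" u] by (simp add: smulR scaleR_conv_of_real)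
  qed (auto simp: add le)
  then have \<phi>: "\<phi> \<in> dual_unit_ball smul" using le by (auto simp: dual_unit_ball_def \<phi>c intro!: onorm_bound)
  have "norm x \<le> norm (\<phi> x)" using complex_Re_le_cmod[of "\<phi> x"] by (simp add: \<phi>_def f(2))
  then show ?thesis using \<phi> le[of x] by (intro bexI[of _ \<phi>]) auto
qed

lemma conjugate_exponent_le_2:
  assumes "2 < q"
  shows "conjugate_exponent q \<le> 2"
proof (cases q)
  case (real t)
  then have "2 < t" using assms by (simp add: numeral_eq_ereal)
  then show ?thesis using real by (simp add: conjugate_exponent_ereal numeral_eq_ereal field_simps)
qed (use assms in \<open>auto simp: conjugate_exponent_infinity\<close>)

theorem proposition2p5:
  shows "(2 < cotype_inf TYPE('a::banach) \<longrightarrow>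
            conjugate_exponent (cotype_inf TYPE('a))
              \<le> domination_index ((*\<^sub>R) :: real \<Rightarrow> 'a \<Rightarrow> 'a)) \<and>
         (\<forall>smul :: complex \<Rightarrow> 'b::banach \<Rightarrow> 'b.
            banach_space_over smul \<longrightarrow> 2 < cotype_inf TYPE('b) \<longrightarrow>
            conjugate_exponent (cotype_inf TYPE('b)) \<le> domination_index smul)"
proof (intro conjI allI impI)
  assume cot: "2 < cotype_inf TYPE('a)"
  have "2 \<le> domination_index ((*\<^sub>R) :: real \<Rightarrow> 'a \<Rightarrow> 'a)"
  proof (rule domination_index_ge_2[OF cot])
    fix \<phi> and B :: "nat set" and x :: "nat \<Rightarrow> 'a" assume \<phi>: "\<phi> \<in> dual_unit_ball ((*\<^sub>R) :: real \<Rightarrow> 'a \<Rightarrow> 'a)" and B: "finite B"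
    show "(\<Sum>i\<in>B. norm (\<phi> (x i))) \<le> 2 * max_signed x B"
      using sum_abs_functional_le_max_signed[OF B, of \<phi> x] max_signed_nonneg[OF B, of x] \<phi>
      by (simp add: dual_unit_ball_real)
  next
    show "\<exists>\<phi>\<in>dual_unit_ball (*\<^sub>R). norm (\<phi> x) = norm x" for x :: 'a
      unfolding dual_unit_ball_real by (rule norming_functional[of x]) (metis abs_norm_cancel real_norm_def)
  qed
  then show "conjugate_exponent (cotype_inf TYPE('a)) \<le> domination_index ((*\<^sub>R) :: real \<Rightarrow> 'a \<Rightarrow> 'a)"
    using conjugate_exponent_le_2[OF cot] by (rule order_trans[rotated])
next
  fix smul :: "complex \<Rightarrow> 'b \<Rightarrow> 'b"
  assume sm: "banach_space_over smul" and cot: "2 < cotype_inf TYPE('b)"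
  have "2 \<le> domination_index smul"
  proof (rule domination_index_ge_2[OF cot])
    fix \<phi> and B :: "nat set" and x :: "nat \<Rightarrow> 'b" assume \<phi>: "\<phi> \<in> dual_unit_ball smul" and B: "finite B"
    have "(\<Sum>i\<in>B. norm (\<phi> (x i))) \<le> (\<Sum>i\<in>B. \<bar>Re (\<phi> (x i))\<bar>) + (\<Sum>i\<in>B. \<bar>Im (\<phi> (x i))\<bar>)"
      unfolding sum.distrib[symmetric] by (intro sum_mono cmod_le)
    also have "\<dots> \<le> max_signed x B + max_signed x B"
      using complex_dual_ball_parts[OF \<phi>] by (intro add_mono sum_abs_functional_le_max_signed[OF B])
    finally show "(\<Sum>i\<in>B. norm (\<phi> (x i))) \<le> 2 * max_signed x B" by simp
  qed (rule complex_norming_functional[OF sm])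
  then show "conjugate_exponent (cotype_inf TYPE('b)) \<le> domination_index smul"
    using conjugate_exponent_le_2[OF cot] by (rule order_trans[rotated])
qed

end
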